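(* Under the standing assumptions in the context (on $h$, $c$, $\bar x,\bar y,\bar\mu$, $\bar c=c(\bar x)$, $\mathcal{M}_{\bar c}$, $A$), there exists a neighborhood $\mathcal N$ of $(\bar x,\bar y,\bar\mu)\in\mathbb{R}^{n}\times\mathbb{R}^m\times\mathbb{R}^{\bar k\ell}$ such that for every $(x,y,\mu)\in\mathcal N$ and every $j\in\mathcal{K}(\bar c)$, $$d^\top\nabla c(x)^\top Q_j\nabla c(x)d+d^\top\nabla^2(yc)(x)d>0\quad\forall\, d\in\mathrm{Null}(A^\top\nabla c(x))\setminus\{0\},\qquad \mathrm{Null}(\nabla c(x)^\top)\cap\mathrm{Ran}(A)=\{0\},$$ and such that if $(x^0,y^0,\mu^0)\in\mathcal N$, then there exists a unique sequence $\{(x^k,y^k,\mu^k)\}_{k\in\mathbb{N}}$ satisfying the optimality conditions of the Newton subproblems (see context) for all $k$, with, for all $k\ge1$ and with $H_{k-1}:=\nabla^2(y^{k-1}c)(x^{k-1})$ and $\hat c^{\,k}:=c(x^{k-1})+\nabla c(x^{k-1})[x^k-x^{k-1}]$: (a) $\hat c^{\,k}\in\mathcal{M}_{\bar c}$; (b) $\mu(\hat c^{\,k},y^k)_j>0$ (componentwise) for all $j\in\{1,\dots,\bar k\}$; (c) $y^k\in\mathrm{ri}(\partial h(\hat c^{\,k}))$; (d) $H_{k-1}[x^k-x^{k-1}]+\nabla c(x^{k-1})^\top y^k=0$; (e) $x^k-x^{k-1}$ is a strong local minimizer of the model function $\phi(d):=h(c(x^{k-1})+\nabla c(x^{k-1})d)+\frac12d^\top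 H_{k-1}d$. Moreover, the sequence $(x^k,y^k)$ converges to $(\bar x,\bar y)$ at a quadratic rate.
   Context: Representation of $h$. $h:\mathbb{R}^m\to\mathbb{R}\cup\{+\infty\}$ is a proper convex function with $\mathrm{int}\,\mathrm{dom}(h)\neq\emptyset$ and $\mathrm{dom}(h)=\bigcup_{k=1}^{\mathcal K}C_k$, where on each $C_k$, $h(c)=\frac12\langle c,Q_kc\rangle+\langle b_k,c\rangle+\beta_k$ ($Q_k$ symmetric), and there are $(a_j,\alpha_j)\in(\mathbb{R}^m\setminus\{0\})\times\mathbb{R}$, $j=1,\dots,s$, and $\omega_{kj}\in\{\pm1\}$ with $C_k=\{c:\langle\omega_{kj}a_j,c\rangle\le\omega_{kj}\alpha_j,\ j=1,\dots,s\}$, $\mathrm{int}\,C_k=\{c:\langle\omega_{kj}a_j,c\rangle<\omega_{kj}\alpha_j,\ j=1,\dots,s\}\ne\emptyset$, and $\mathrm{int}\,C_{k_1}\cap\mathrm{int}\,C_{k_2}=\emptyset$ for $k_1\ne k_2$ (Rockafellar-Wets PLQ representation). Let $\mathcal K(c)=\{k:c\in C_k\}$ and $I_k(c)=\{j:\langle a_j,c\rangle=\alpha_j\}$. Active manifold and matrices. $c:\mathbb{R}^n\to\mathbb{R}^m$ is $C^3$-smooth, $f=h\circ c$, $\bar x\in\mathrm{dom}(f)$, $\bar c=c(\bar x)$, $\mathcal K(\bar c)=\{k_1,\dots,k_{\bar k}\}$ with $\bar k\ge2$, $\mathcal M_{\bar c}:=\mathrm{ri}\big(\bigcap_{k\in\mathcal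 K(\bar c)}C_k\big)$, with $\bar c\in\mathcal M_{\bar c}$. Let $\ell=|I_k(\bar c)|$ (independent of $k\in\mathcal K(\bar c)$; the active index sets are constant on $\mathcal M_{\bar c}$). $A\in\mathbb{R}^{m\times\ell}$ has columns $\omega_{k_{\bar k}j}a_j$, $j\in I_{k_{\bar k}}(\bar c)$, in a fixed order, and $P_i\in\mathbb{R}^{\ell\times\ell}$ ($i=1,\dots,\bar k$) is the diagonal matrix with $\pm1$ entries such that $AP_i$ has columns $\omega_{k_ij}a_j$ in the same order ($P_{\bar k}=I$). Assumptions. (i) Nondegeneracy: $\mathrm{Null}(A)=\{0\}$. (ii) Strict criticality: $\mathrm{Null}(\nabla c(\bar x)^\top)\cap\mathrm{ri}(\partial h(\bar c))=\{\bar y\}$, and $\bar\mu=(\bar\mu_1^\top,\dots,\bar\mu_{\bar k}^\top)^\top\in\mathbb{R}^{\bar k\ell}$ satisfies $\bar y=Q_{k_i}\bar c+b_{k_i}+AP_i\bar\mu_i$ for all $i$, with $\bar\mu>0$ componentwise. (iii) Second-order sufficiency: $h''(\bar c;\nabla c(\bar x)d)+\langle d,\nabla^2(\bar yc)(\bar x)d\rangle>0$ for all $d\in\mathrm{Null}(A^\top\nabla c(\bar x))\setminus\{0\}$. Notation. $\nabla c(x)$ is the $m\times n$ Jacobian, $(yc)(x)=\langle y,c(x)\rangle$, $h''(c;w)=\lim_{t\searrow0}\frac{h(c+tw)-h(c)-th'(c;w)}{t^2/2}$. For $c\in\mathcal M_{\bar c}$ and $y\in\partial h(c)$, $\mu(c,y)=(\mu(c,y)_1,\dots,\mu(c,y)_{\bar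 k})$ with $\mu(c,y)_i=P_i(A^\top A)^{-1}A^\top(y-Q_{k_i}c-b_{k_i})$; it is the unique $\mu\ge 0$ with $y=Q_{k_i}c+b_{k_i}+AP_i\mu_i$ for all $i$. Newton subproblem at $(x^{k-1},y^{k-1})$: minimize over $x$ the function $h(c(x^{k-1})+\nabla c(x^{k-1})[x-x^{k-1}])+\frac12[x-x^{k-1}]^\top H_{k-1}[x-x^{k-1}]$. Its optimality conditions for $(x^k,y^k)$ are $H_{k-1}[x^k-x^{k-1}]+\nabla c(x^{k-1})^\top y^k=0$ and $y^k\in\partial h(c(x^{k-1})+\nabla c(x^{k-1})[x^k-x^{k-1}])$; $\mu^k=(\mu^k_1,\dots,\mu^k_{\bar k})\geq 0$ denotes the multiplier vector representing this subgradient, i.e. $y^k=Q_{k_i}\hat c^{\,k}+b_{k_i}+AP_i\mu^k_i$ for all $i$. A point $\bar d$ is a strong local minimizer of $\phi$ if $\phi(d)\ge\phi(\bar d)+\gamma\|d-\bar d\|^2$ for some $\gamma>0$ and all $d\in\mathrm{dom}(\phi)$ near $\bar d$. *)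

theory Defs
  imports "HOL-Analysis.Analysis"
begin

section \<open>Extended-real-valued convex functions\<close>

definition effective_dom :: "('a \<Rightarrow> ereal) \<Rightarrow> 'a set" where
  "effective_dom h = {z. h z < \<infinity>}"

definition proper_fun :: "('a \<Rightarrow> ereal) \<Rightarrow> bool" where
  "proper_fun h \<longleftrightarrow> (\<forall>z. h z \<noteq> -\<infinity>) \<and> effective_dom h \<noteq> {}"

definition convex_fun :: "('a::real_vector \<Rightarrow> ereal) \<Rightarrow> bool" where
  "convex_fun h \<longleftrightarrow>
     (\<forall>z w. \<forall>t\<in>{0<..<1}.
        h ((1 - t) *\<^sub>R z + t *\<^sub>R w) \<le> ereal (1 - t) * h z + ereal t * h w)"

definition subdifferential :: "('a::real_inner \<Rightarrow> ereal) \<Rightarrow> 'a \<Rightarrow> 'a set" where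
  "subdifferential h z =
     {y. z \<in> effective_dom h \<and> (\<forall>w. h z + ereal (y \<bullet> (w - z)) \<le> h w)}"

text \<open>
  The two directional derivatives are limits in the extended reals; as usual for \<^const>\<open>Lim\<close>,
  the value is meaningful only where the limit exists, and for the second one only where
  the first one is finite.
\<close>

definition dir_deriv :: "('a::real_vector \<Rightarrow> ereal) \<Rightarrow> 'a \<Rightarrow> 'a \<Rightarrow> ereal" where
  "dir_deriv h z w = Lim (at_right 0) (\<lambda>t::real. (h (z + t *\<^sub>R w) - h z) / ereal t)"

definition second_dir_deriv :: "('a::real_vector \<Rightarrow> ereal) \<Rightarrow> 'a \<Rightarrow> 'a \<Rightarrow> ereal" where
  "second_dir_deriv h z w =
     Lim (at_right 0)
       (\<lambda>t::real. (h (z + t *\<^sub>R w) - h z - ereal t * dir_deriv h z w) / ereal (t\<^sup>2 / 2))"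

definition strong_local_minimizer :: "('a::real_normed_vector \<Rightarrow> ereal) \<Rightarrow> 'a \<Rightarrow> bool" where
  "strong_local_minimizer \<phi> z \<longleftrightarrow>
     z \<in> effective_dom \<phi> \<and>
     (\<exists>\<gamma>>0. \<forall>\<^sub>F w in nhds z.
        w \<in> effective_dom \<phi> \<longrightarrow> \<phi> z + ereal (\<gamma> * (norm (w - z))\<^sup>2) \<le> \<phi> w)"


section \<open>Smoothness, Hessians, linear algebra, rates\<close>

text \<open>
  \<open>C_smooth k f\<close>: \<open>f\<close> is \<open>k\<close> times continuously differentiable on the whole space. The
  recursion goes through directional derivatives along fixed vectors, which in finite
  dimension is equivalent to continuity of the \<open>k\<close>-th Frechet derivative.
\<close>

primrec C_smooth :: "nat \<Rightarrow> ('a::euclidean_space \<Rightarrow> 'b::euclidean_space) \<Rightarrow> bool" where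
  "C_smooth 0 f \<longleftrightarrow> continuous_on UNIV f"
| "C_smooth (Suc k) f \<longleftrightarrow>
     (\<forall>x. f differentiable at x) \<and> (\<forall>v. C_smooth k (\<lambda>x. frechet_derivative f (at x) v))"

definition gradient :: "(real^'n \<Rightarrow> real) \<Rightarrow> real^'n \<Rightarrow> real^'n" where
  "gradient f x = (\<chi> i. frechet_derivative f (at x) (axis i 1))"

definition hessian :: "(real^'n \<Rightarrow> real) \<Rightarrow> real^'n \<Rightarrow> real^'n^'n" where
  "hessian f x = jacobian (gradient f) (at x)"

definition Null :: "real^'n^'m \<Rightarrow> (real^'n) set" where
  "Null B = {v. B *v v = 0}"

definition Ran :: "real^'n^'m \<Rightarrow> (real^'m) set" where
  "Ran B = range (\<lambda>v. B *v v)"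

definition converges_quadratically :: "(nat \<Rightarrow> 'a::real_normed_vector) \<Rightarrow> 'a \<Rightarrow> bool" where
  "converges_quadratically u l \<longleftrightarrow>
     u \<longlonglongrightarrow> l \<and> (\<exists>C::real. \<forall>k. norm (u (Suc k) - l) \<le> C * (norm (u k - l))\<^sup>2)"


section \<open>Piecewise linear-quadratic functions\<close>

text \<open>
  The pieces are indexed by a finite type \<open>'k\<close> and the hyperplanes by a finite type \<open>'j\<close>;
  \<open>\<omega> k j\<close> is the side of the \<open>j\<close>-th hyperplane on which the \<open>k\<close>-th piece lies.
\<close>

definition piece ::
  "('j \<Rightarrow> real^'m) \<Rightarrow> ('j \<Rightarrow> real) \<Rightarrow> ('k \<Rightarrow> 'j \<Rightarrow> real) \<Rightarrow> 'k \<Rightarrow> (real^'m) set" where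
  "piece a \<alpha> \<omega> k = {z. \<forall>j. (\<omega> k j *\<^sub>R a j) \<bullet> z \<le> \<omega> k j * \<alpha> j}"

definition plq_representation ::
  "(real^'m \<Rightarrow> ereal) \<Rightarrow> ('k::finite \<Rightarrow> real^'m^'m) \<Rightarrow> ('k \<Rightarrow> real^'m) \<Rightarrow> ('k \<Rightarrow> real) \<Rightarrow>
   ('j::finite \<Rightarrow> real^'m) \<Rightarrow> ('j \<Rightarrow> real) \<Rightarrow> ('k \<Rightarrow> 'j \<Rightarrow> real) \<Rightarrow> bool" where
  "plq_representation h Q b \<beta> a \<alpha> \<omega> \<longleftrightarrow>
     proper_fun h \<and> convex_fun h \<and> interior (effective_dom h) \<noteq> {} \<and>
     effective_dom h = (\<Union>k. piece a \<alpha> \<omega> k) \<and>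
     (\<forall>k. transpose (Q k) = Q k) \<and>
     (\<forall>k. \<forall>z\<in>piece a \<alpha> \<omega> k. h z = ereal (1/2 * (z \<bullet> (Q k *v z)) + b k \<bullet> z + \<beta> k)) \<and>
     (\<forall>j. a j \<noteq> 0) \<and>
     (\<forall>k j. \<omega> k j \<in> {1, -1}) \<and>
     (\<forall>k. interior (piece a \<alpha> \<omega> k) = {z. \<forall>j. (\<omega> k j *\<^sub>R a j) \<bullet> z < \<omega> k j * \<alpha> j}) \<and>
     (\<forall>k. interior (piece a \<alpha> \<omega> k) \<noteq> {}) \<and>
     (\<forall>k1 k2. k1 \<noteq> k2 \<longrightarrow> interior (piece a \<alpha> \<omega> k1) \<inter> interior (piece a \<alpha> \<omega> k2) = {})"

definition active_pieces ::
  "('j \<Rightarrow> real^'m) \<Rightarrow> ('j \<Rightarrow> real) \<Rightarrow> ('k \<Rightarrow> 'j \<Rightarrow> real) \<Rightarrow> real^'m \<Rightarrow> 'k set" where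
  "active_pieces a \<alpha> \<omega> z = {k. z \<in> piece a \<alpha> \<omega> k}"

text \<open>
  All pieces are cut out by the same hyperplanes, so the active index set at a point does not
  depend on the piece containing it.
\<close>

definition active_hyperplanes :: "('j \<Rightarrow> real^'m) \<Rightarrow> ('j \<Rightarrow> real) \<Rightarrow> real^'m \<Rightarrow> 'j set" where
  "active_hyperplanes a \<alpha> z = {j. a j \<bullet> z = \<alpha> j}"


section \<open>Multipliers and the Newton iteration\<close>

text \<open>
  A finite type \<open>'b\<close> enumerates the active pieces at the reference point (through \<open>\<kappa>\<close>), and a
  finite type \<open>'l\<close> the active hyperplanes; \<open>real^'l^'b\<close> holds a stacked multiplier vector
  with one block in \<open>real^'l\<close> per active piece.
\<close>

definition multiplier ::
  "('k \<Rightarrow> real^'m^'m) \<Rightarrow> ('k \<Rightarrow> real^'m) \<Rightarrow> ('b::finite \<Rightarrow> 'k) \<Rightarrow> real^'l^'m \<Rightarrow>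
   ('b \<Rightarrow> real^'l^'l) \<Rightarrow> real^'m \<Rightarrow> real^'m \<Rightarrow> real^'l^'b" where
  "multiplier Q b \<kappa> A P z y =
     (\<chi> i. P i *v (matrix_inv (transpose A ** A) *v
                    (transpose A *v (y - Q (\<kappa> i) *v z - b (\<kappa> i)))))"

definition represents ::
  "('k \<Rightarrow> real^'m^'m) \<Rightarrow> ('k \<Rightarrow> real^'m) \<Rightarrow> ('b::finite \<Rightarrow> 'k) \<Rightarrow> real^'l^'m \<Rightarrow>
   ('b \<Rightarrow> real^'l^'l) \<Rightarrow> real^'m \<Rightarrow> real^'m \<Rightarrow> real^'l^'b \<Rightarrow> bool" where
  "represents Q b \<kappa> A P z y \<mu> \<longleftrightarrow>
     (\<forall>i. y = Q (\<kappa> i) *v z + b (\<kappa> i) + (A ** P i) *v (\<mu> $ i))"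

definition linearized :: "(real^'n \<Rightarrow> real^'m) \<Rightarrow> real^'n \<Rightarrow> real^'n \<Rightarrow> real^'m" where
  "linearized c x x' = c x + jacobian c (at x) *v (x' - x)"

definition lagrangian_hessian ::
  "(real^'n \<Rightarrow> real^'m) \<Rightarrow> real^'m \<Rightarrow> real^'n \<Rightarrow> real^'n^'n" where
  "lagrangian_hessian c y x = hessian (\<lambda>z. y \<bullet> c z) x"

text \<open>
  Optimality conditions, at the triple \<open>(x', y', \<mu>')\<close>, of the Newton subproblem generated by
  \<open>(x, y)\<close>, including the requirement that \<open>\<mu>'\<close> is a multiplier vector of the subgradient \<open>y'\<close>.
\<close>

definition newton_optimality ::
  "(real^'m \<Rightarrow> ereal) \<Rightarrow> (real^'n \<Rightarrow> real^'m) \<Rightarrow>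
   ('k \<Rightarrow> real^'m^'m) \<Rightarrow> ('k \<Rightarrow> real^'m) \<Rightarrow> ('b::finite \<Rightarrow> 'k) \<Rightarrow> real^'l^'m \<Rightarrow> ('b \<Rightarrow> real^'l^'l) \<Rightarrow>
   real^'n \<Rightarrow> real^'m \<Rightarrow> real^'n \<Rightarrow> real^'m \<Rightarrow> real^'l^'b \<Rightarrow> bool" where
  "newton_optimality h c Q b \<kappa> A P x y x' y' \<mu>' \<longleftrightarrow>
     lagrangian_hessian c y x *v (x' - x) + transpose (jacobian c (at x)) *v y' = 0 \<and>
     y' \<in> subdifferential h (linearized c x x') \<and>
     (\<forall>i p. \<mu>' $ i $ p \<ge> 0) \<and>
     represents Q b \<kappa> A P (linearized c x x') y' \<mu>'"

definition newton_sequence ::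
  "(real^'m \<Rightarrow> ereal) \<Rightarrow> (real^'n \<Rightarrow> real^'m) \<Rightarrow>
   ('k \<Rightarrow> real^'m^'m) \<Rightarrow> ('k \<Rightarrow> real^'m) \<Rightarrow> ('b::finite \<Rightarrow> 'k) \<Rightarrow> real^'l^'m \<Rightarrow> ('b \<Rightarrow> real^'l^'l) \<Rightarrow>
   (nat \<Rightarrow> real^'n) \<Rightarrow> (nat \<Rightarrow> real^'m) \<Rightarrow> (nat \<Rightarrow> real^'l^'b) \<Rightarrow> bool" where
  "newton_sequence h c Q b \<kappa> A P xs ys \<mu>s \<longleftrightarrow>
     (\<forall>k. newton_optimality h c Q b \<kappa> A P (xs k) (ys k) (xs (Suc k)) (ys (Suc k)) (\<mu>s (Suc k)))"

definition newton_model ::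
  "(real^'m \<Rightarrow> ereal) \<Rightarrow> (real^'n \<Rightarrow> real^'m) \<Rightarrow> real^'n \<Rightarrow> real^'m \<Rightarrow> real^'n \<Rightarrow> ereal" where
  "newton_model h c x y d =
     h (c x + jacobian c (at x) *v d) + ereal (1/2 * (d \<bullet> (lagrangian_hessian c y x *v d)))"

end

theory Submission
  imports Defs
begin

text \<open>
  At a point of the active manifold, strictly positive multipliers make every active hyperplane
  binding: a subgradient with positive multipliers can only live on the manifold. Near the
  reference point a Newton subproblem is therefore an equality-constrained one, and its optimality
  conditions become one step of Newton's method for the smooth KKT system in \<open>(x, y, \<lambda>)\<close> with one
  fixed piece. Second-order sufficiency and transversality make the derivative of that system
  injective, uniformly near the solution, and inserting the solution into the linearised system
  leaves a quadratic residual; this gives existence, uniqueness and the quadratic rate.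
  Transversality itself comes from strict criticality: moving \<open>ybar\<close> inside
  \<open>Null (transpose (jacobian c (at xbar))) \<inter> Ran A\<close> would not leave the relative interior of the
  subdifferential.
\<close>

text \<open>The obstacle is a mismatch of domains: second-order sufficiency controls only directions
  in the null space of \<open>transpose A ** J xbar\<close>, while strong local minimality compares
  with every nearby point, on or off the manifold, and for base points \<open>(x, y)\<close> whose
  null space has moved. Both are met by a penalised form: positivity on a null space becomes
  positivity on the whole space after adding \<open>K\<close> times the squared norm of the
  constraint violation, and this version survives perturbation with one \<open>K\<close> and one
  \<open>\<gamma>\<close>. The penalty is paid for by the strictly positive multipliers, because
  they contribute a term linear in the violation, which beats a quadratic one near zero. The chart
  turns the active pieces, inside one ball, into sets cut out by sign conditions on
  \<open>transpose A *v (z - cbar)\<close>; from a point of the manifold, lying in a piece is then a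
  condition on the direction alone. Convexity of \<open>h\<close> is what turns inequalities
  obtained inside this ball into global subgradient inequalities.\<close>

declare transpose_matrix_vector [simp del]

section \<open>Second derivatives\<close>

text \<open>The mean value theorem in direction \<open>v\<close>, applied to the first difference in
  direction \<open>w\<close>, leaves a difference of \<open>G _ v\<close> at two points near
  \<open>x\<close>; differentiability of \<open>\<lambda>z. G z v\<close> at the single point
  \<open>x\<close> evaluates it. No continuity of second derivatives is used.\<close>

lemma second_difference_tendsto:
  fixes f :: "'a::real_normed_vector \<Rightarrow> real"
  assumes D: "\<And>z. (f has_derivative G z) (at z)"
    and F: "((\<lambda>z. G z v) has_derivative F) (at x)"
  shows "((\<lambda>t. (f (x + t *\<^sub>R v + t *\<^sub>R w) - f (x + t *\<^sub>R v) - f (x + t *\<^sub>R w) + f x) / t\<^sup>2) \<longlongrightarrow> F w)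
    (at_right 0)"
proof (rule tendstoI)
  fix e :: real assume "e > 0"
  define r where "r = norm v + norm w + 1"
  have r: "r > 0" by (simp add: r_def add_nonneg_pos)
  from F interpret F: bounded_linear F by (rule has_derivative_bounded_linear)
  \<comment> \<open>Two points at distance at most \<open>t * r\<close> from \<open>x\<close> are
    compared with \<open>x\<close>; each costs \<open>e / 4 * t\<close>, leaving
    \<open>e / 2\<close> after division by \<open>t\<close>.\<close>
  have "e / (4 * r) > 0" using \<open>e > 0\<close> r by simp
  with F obtain d where "d > 0"
    and d: "\<And>z. norm (z - x) < d \<Longrightarrow> \<bar>G z v - G x v - F (z - x)\<bar> \<le> e / (4 * r) * norm (z - x)"
    unfolding has_derivative_at_alt real_norm_def by metis
  have "\<bar>(f (x + t *\<^sub>R v + t *\<^sub>R w) - f (x + t *\<^sub>R v) - f (x + t *\<^sub>R w) + f x) / t\<^sup>2 - F w\<bar> < e"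
    if t: "0 < t" "t < d / r" for t
  proof -
    have td: "t * r < d" using t r by (simp add: field_simps)
    have close: "\<bar>G z v - G x v - F (z - x)\<bar> \<le> e / 4 * t" if "norm (z - x) \<le> t * r" for z
    proof -
      have "\<bar>G z v - G x v - F (z - x)\<bar> \<le> e / (4 * r) * norm (z - x)"
        using that td by (intro d) simp
      also have "\<dots> \<le> e / (4 * r) * (t * r)"
        using that \<open>e > 0\<close> r by (intro mult_left_mono) auto
      also have "\<dots> = e / 4 * t" using r by simp
      finally show ?thesis .
    qed
    define g where "g s = f (x + (s * t) *\<^sub>R v + t *\<^sub>R w) - f (x + (s * t) *\<^sub>R v)" for s
    have "(g has_derivative (\<lambda>k. G (x + (s * t) *\<^sub>R v + t *\<^sub>R w) ((k * t) *\<^sub>R v)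
            - G (x + (s * t) *\<^sub>R v) ((k * t) *\<^sub>R v))) (at s within {0..1})" for s
      unfolding g_def
      by (rule has_derivative_diff; rule has_derivative_compose[OF _ D];
          auto intro!: derivative_eq_intros)
    from mvt_very_simple[of 0 1 g, OF _ this] obtain s where s: "0 \<le> s" "s \<le> 1"
      and "g 1 - g 0 = G (x + (s * t) *\<^sub>R v + t *\<^sub>R w) (t *\<^sub>R v) - G (x + (s * t) *\<^sub>R v) (t *\<^sub>R v)"
      by auto
    define p q where "p = x + (s * t) *\<^sub>R v + t *\<^sub>R w" and "q = x + (s * t) *\<^sub>R v"
    have scale: "G z (t *\<^sub>R v) = t * G z v" for z
      using D[of z] by (simp add: has_derivative_bounded_linear linear_simps)
    have eq: "g 1 - g 0 = t * (G p v - G q v)"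
      using \<open>g 1 - g 0 = _\<close> by (simp add: p_def q_def scale right_diff_distrib)
    have st: "s * t * norm v \<le> t * norm v" using s t by (simp add: mult_left_le_one_le mult_right_mono)
    have "norm (p - x) \<le> s * t * norm v + t * norm w"
      using s t norm_triangle_ineq[of "(s * t) *\<^sub>R v" "t *\<^sub>R w"] by (simp add: p_def add.assoc)
    also have "\<dots> \<le> t * (norm v + norm w)" unfolding distrib_left using st by linarith
    also have "\<dots> \<le> t * r" using t by (simp add: r_def)
    finally have "\<bar>G p v - G x v - F (p - x)\<bar> \<le> e / 4 * t" by (rule close)
    moreover have "norm (q - x) = s * t * norm v" using s t by (simp add: q_def)
    then have "norm (q - x) \<le> t * norm v" using st by linarith
    then have "norm (q - x) \<le> t * r"
      using t by (elim order_trans) (simp add: r_def)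
    then have "\<bar>G q v - G x v - F (q - x)\<bar> \<le> e / 4 * t" by (rule close)
    moreover have "F (p - x) - F (q - x) = F (t *\<^sub>R w)"
      unfolding F.diff[symmetric] by (simp add: p_def q_def)
    then have "F (p - x) - F (q - x) = t * F w" by (simp add: F.scaleR)
    ultimately have "\<bar>(G p v - G q v) - t * F w\<bar> \<le> e / 2 * t" by linarith
    then have "\<bar>t * (G p v - G q v - t * F w)\<bar> \<le> t * (e / 2 * t)"
      using t by (simp add: abs_mult)
    then have "\<bar>(g 1 - g 0) - t\<^sup>2 * F w\<bar> \<le> e / 2 * t\<^sup>2"
      by (simp add: eq algebra_simps power2_eq_square)
    moreover have "(g 1 - g 0) / t\<^sup>2 - F w = ((g 1 - g 0) - t\<^sup>2 * F w) / t\<^sup>2"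
      using t by (simp add: field_simps)
    ultimately have "\<bar>(g 1 - g 0) / t\<^sup>2 - F w\<bar> \<le> e / 2"
      using t by (simp add: abs_divide pos_divide_le_eq)
    moreover have "g 1 - g 0 = f (x + t *\<^sub>R v + t *\<^sub>R w) - f (x + t *\<^sub>R v) - f (x + t *\<^sub>R w) + f x"
      by (simp add: g_def)
    ultimately show ?thesis using \<open>e > 0\<close> by simp
  qed
  moreover have "d / r > 0" using \<open>d > 0\<close> r by simp
  ultimately show "\<forall>\<^sub>F t in at_right 0.
      dist ((f (x + t *\<^sub>R v + t *\<^sub>R w) - f (x + t *\<^sub>R v) - f (x + t *\<^sub>R w) + f x) / t\<^sup>2) (F w) < e"
    unfolding dist_real_def eventually_at_right_field by blast
qed

text \<open>The second difference quotient does not change when \<open>v\<close> and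
  \<open>w\<close> are swapped, so its limit is both \<open>Fv w\<close> and
  \<open>Fw v\<close>.\<close>

lemma second_derivative_symmetric:
  fixes f :: "'a::real_normed_vector \<Rightarrow> real"
  assumes D: "\<And>z. (f has_derivative G z) (at z)"
    and "((\<lambda>z. G z v) has_derivative Fv) (at x)" "((\<lambda>z. G z w) has_derivative Fw) (at x)"
  shows "Fv w = Fw v"
proof (rule tendsto_unique)
  show "((\<lambda>t. (f (x + t *\<^sub>R v + t *\<^sub>R w) - f (x + t *\<^sub>R v) - f (x + t *\<^sub>R w) + f x) / t\<^sup>2) \<longlongrightarrow> Fv w)
    (at_right 0)"
    by (rule second_difference_tendsto[OF D assms(2)])
  show "((\<lambda>t. (f (x + t *\<^sub>R v + t *\<^sub>R w) - f (x + t *\<^sub>R v) - f (x + t *\<^sub>R w) + f x) / t\<^sup>2) \<longlongrightarrow> Fw v)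
    (at_right 0)"
    using second_difference_tendsto[OF D assms(3), of v] by (simp add: algebra_simps)
qed simp

section \<open>Uniform estimates for families of linear maps and for linearisation errors\<close>

lemma norm_linear_le_Basis:
  fixes L :: "'a::euclidean_space \<Rightarrow> 'b::real_normed_vector"
  assumes "linear L"
  shows "norm (L u) \<le> (\<Sum>b\<in>Basis. norm (L b)) * norm u"
proof -
  have "L u = (\<Sum>b\<in>Basis. (u \<bullet> b) *\<^sub>R L b)"
    using linear_sum[OF assms, of "\<lambda>b. (u \<bullet> b) *\<^sub>R b" Basis] linear_scale[OF assms]
    by (simp add: euclidean_representation)
  then have "norm (L u) \<le> (\<Sum>b\<in>Basis. \<bar>u \<bullet> b\<bar> * norm (L b))"
    using norm_sum[of "\<lambda>b. (u \<bullet> b) *\<^sub>R L b" Basis] by simp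
  also have "\<dots> \<le> (\<Sum>b\<in>Basis. norm u * norm (L b))"
    by (intro sum_mono mult_right_mono) (auto simp: Basis_le_norm)
  finally show ?thesis by (simp add: sum_distrib_left mult.commute)
qed

text \<open>In finite dimension pointwise convergence of linear maps is uniform on bounded sets,
  because only the images of the finitely many basis vectors matter.\<close>

lemma linear_family_perturbation:
  fixes T :: "'z::topological_space \<Rightarrow> 'a::euclidean_space \<Rightarrow> 'b::real_normed_vector"
  assumes lin: "\<And>z. linear (T z)" and cont: "\<And>u. ((\<lambda>z. T z u) \<longlongrightarrow> T z0 u) (nhds z0)"
    and "e > 0"
  shows "\<forall>\<^sub>F z in nhds z0. \<forall>u. norm (T z u - T z0 u) \<le> e * norm u"
proof -
  have "((\<lambda>z. \<Sum>b\<in>Basis. norm (T z b - T z0 b)) \<longlongrightarrow> (\<Sum>b\<in>Basis. norm (T z0 b - T z0 b))) (nhds z0)"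
    by (intro tendsto_intros cont)
  then have "\<forall>\<^sub>F z in nhds z0. (\<Sum>b\<in>Basis. norm (T z b - T z0 b)) < e"
    using \<open>e > 0\<close> by (auto dest: order_tendstoD)
  then show ?thesis
  proof eventually_elim
    case (elim z)
    show ?case
    proof
      fix u
      have "norm (T z u - T z0 u) \<le> (\<Sum>b\<in>Basis. norm (T z b - T z0 b)) * norm u"
        by (rule norm_linear_le_Basis[OF linear_compose_sub[OF lin lin]])
      also have "\<dots> \<le> e * norm u" using elim by (intro mult_right_mono) auto
      finally show "norm (T z u - T z0 u) \<le> e * norm u" .
    qed
  qed
qed

text \<open>An injective linear map is bounded below by some \<open>B\<close>; a perturbation of
  size \<open>B / 2\<close> leaves the bound \<open>B / 2\<close>.\<close>

lemma eventually_uniformly_injective: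
  fixes T :: "'z::topological_space \<Rightarrow> 'a::euclidean_space \<Rightarrow> 'b::euclidean_space"
  assumes lin: "\<And>z. linear (T z)" and cont: "\<And>u. ((\<lambda>z. T z u) \<longlongrightarrow> T z0 u) (nhds z0)"
    and inj: "\<And>u. T z0 u = 0 \<Longrightarrow> u = 0"
  shows "\<exists>\<gamma>>0. \<forall>\<^sub>F z in nhds z0. \<forall>u. \<gamma> * norm u \<le> norm (T z u)"
proof -
  have "inj (T z0)" using inj linear_injective_0[OF lin] by blast
  with lin obtain B where B: "B > 0" "\<And>u. B * norm u \<le> norm (T z0 u)"
    using linear_inj_bounded_below_pos by metis
  have "\<forall>\<^sub>F z in nhds z0. \<forall>u. norm (T z u - T z0 u) \<le> B / 2 * norm u"
    using B by (intro linear_family_perturbation lin cont) auto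
  then have "\<forall>\<^sub>F z in nhds z0. \<forall>u. B / 2 * norm u \<le> norm (T z u)"
  proof eventually_elim
    case (elim z)
    show ?case
    proof
      fix u
      show "B / 2 * norm u \<le> norm (T z u)"
        using elim[rule_format, of u] B(2)[of u] norm_triangle_ineq2[of "T z0 u" "T z u"]
        by (simp add: norm_minus_commute)
    qed
  qed
  with B(1) show ?thesis by (intro exI[of _ "B / 2"]) auto
qed

text \<open>The expansion point is the moving \<open>x\<close> and the target is the fixed
  \<open>p\<close>, as Newton's method requires. Differentiability of \<open>G\<close> at
  \<open>p\<close> alone gives a Lipschitz estimate only against \<open>G p\<close>; comparing
  \<open>G z\<close> and \<open>G x\<close> through \<open>G p\<close> costs the factor 2.\<close>

lemma linearization_error_quadratic:
  fixes g :: "'a::euclidean_space \<Rightarrow> 'b::real_normed_vector"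
  assumes D: "\<And>z. (g has_derivative G z) (at z)" and D2: "\<And>v. (\<lambda>z. G z v) differentiable at p"
  shows "\<exists>C. \<forall>\<^sub>F x in nhds p. norm (g p - g x - G x (p - x)) \<le> C * (norm (x - p))\<^sup>2"
proof -
  have linG: "linear (G z)" for z using D has_derivative_linear by blast
  have "\<exists>C. \<forall>\<^sub>F z in nhds p. norm (G z v - G p v) \<le> C * norm (z - p)" for v
  proof -
    obtain F where F: "((\<lambda>z. G z v) has_derivative F) (at p)" using D2[of v] unfolding differentiable_def by blast
    then interpret F: bounded_linear F by (rule has_derivative_bounded_linear)
    obtain d where "d > 0"
      and d: "\<And>z. norm (z - p) < d \<Longrightarrow> norm (G z v - G p v - F (z - p)) \<le> 1 * norm (z - p)"
      using F unfolding has_derivative_at_alt by (metis zero_less_one)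
    have "norm (G z v - G p v) \<le> (1 + onorm F) * norm (z - p)" if "norm (z - p) < d" for z
      using d[OF that] onorm[OF F.bounded_linear_axioms, of "z - p"]
        norm_triangle_ineq[of "G z v - G p v - F (z - p)" "F (z - p)"]
      by (simp add: algebra_simps)
    with \<open>d > 0\<close> show ?thesis
      unfolding eventually_nhds_metric dist_norm by blast
  qed
  then obtain C where C: "\<And>v. \<forall>\<^sub>F z in nhds p. norm (G z v - G p v) \<le> C v * norm (z - p)" by metis
  define K where "K = (\<Sum>b\<in>Basis. C b)"
  have "\<forall>\<^sub>F z in nhds p. \<forall>b\<in>Basis. norm (G z b - G p b) \<le> C b * norm (z - p)"
    by (intro eventually_ball_finite ballI C) simp
  then obtain d where "d > 0"
    and d: "\<And>z b. norm (z - p) < d \<Longrightarrow> b \<in> Basis \<Longrightarrow> norm (G z b - G p b) \<le> C b * norm (z - p)"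
    unfolding eventually_nhds_metric dist_norm by blast
  have Lip: "norm (G z v - G p v) \<le> K * norm (z - p) * norm v" if "norm (z - p) < d" for z v
  proof -
    have "norm (G z v - G p v) \<le> (\<Sum>b\<in>Basis. norm (G z b - G p b)) * norm v"
      by (rule norm_linear_le_Basis[OF linear_compose_sub[OF linG linG]])
    also have "\<dots> \<le> (\<Sum>b\<in>Basis. C b * norm (z - p)) * norm v"
      using that by (intro mult_right_mono sum_mono d) auto
    finally show ?thesis by (simp add: K_def sum_distrib_right)
  qed
  have "norm (g p - g x - G x (p - x)) \<le> 2 * \<bar>K\<bar> * (norm (x - p))\<^sup>2" if x: "norm (x - p) < d" for x
  proof -
    have Lip': "norm (G z v - G p v) \<le> \<bar>K\<bar> * norm (x - p) * norm v" if "norm (z - p) \<le> norm (x - p)" for z v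
    proof -
      have "norm (G z v - G p v) \<le> K * norm (z - p) * norm v" using Lip x that by simp
      also have "\<dots> \<le> \<bar>K\<bar> * norm (x - p) * norm v"
        using that by (intro mult_right_mono mult_mono) auto
      finally show ?thesis .
    qed
    \<comment> \<open>Mean value inequality for \<open>g - G x\<close> on the ball about
      \<open>p\<close> that has \<open>x\<close> on its boundary: it is convex, contains both
      points, and every \<open>z\<close> in it satisfies the Lipschitz estimate.\<close>
    have "norm ((g p - G x p) - (g x - G x x)) \<le> (2 * \<bar>K\<bar> * norm (x - p)) * norm (p - x)"
    proof (rule differentiable_bound[where S = "cball p (norm (x - p))" and f' = "\<lambda>z v. G z v - G x v"])
      fix z assume z: "z \<in> cball p (norm (x - p))"
      have "(G x has_derivative G x) (at z within cball p (norm (x - p)))"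
        using D has_derivative_bounded_linear bounded_linear_imp_has_derivative by blast
      then show "((\<lambda>z. g z - G x z) has_derivative (\<lambda>v. G z v - G x v))
          (at z within cball p (norm (x - p)))"
        by (intro has_derivative_diff has_derivative_at_withinI[OF D])
      show "onorm (\<lambda>v. G z v - G x v) \<le> 2 * \<bar>K\<bar> * norm (x - p)"
      proof (rule onorm_bound)
        fix v
        have "norm (G z v - G x v) \<le> norm (G z v - G p v) + norm (G x v - G p v)"
          using norm_triangle_ineq4[of "G z v - G p v" "G x v - G p v"] by simp
        also have "\<dots> \<le> 2 * (\<bar>K\<bar> * norm (x - p) * norm v)"
          using Lip'[of z v] Lip'[of x v] z by (simp add: dist_norm norm_minus_commute)
        finally show "norm (G z v - G x v) \<le> 2 * \<bar>K\<bar> * norm (x - p) * norm v" by simp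
      qed simp
    qed (auto simp: dist_norm norm_minus_commute)
    then show ?thesis
      by (simp add: linear_diff[OF linG] algebra_simps power2_eq_square norm_minus_commute)
  qed
  with \<open>d > 0\<close> show ?thesis
    unfolding eventually_nhds_metric dist_norm by blast
qed

section \<open>Linear algebra\<close>

text \<open>Finsler's lemma by compactness: on the part of the unit sphere where the form is
  nonpositive, \<open>S *v v\<close> never vanishes, so its norm is bounded away from zero there and
  a large \<open>K\<close> wins; homogeneity then extends the bound to all \<open>v\<close>.\<close>

lemma quadratic_form_penalty:
  fixes B :: "real^'n^'n" and S :: "real^'n^'l"
  assumes pos: "\<And>v. S *v v = 0 \<Longrightarrow> v \<noteq> 0 \<Longrightarrow> v \<bullet> (B *v v) > 0"
  shows "\<exists>K\<ge>0. \<exists>\<gamma>>0. \<forall>v. \<gamma> * (norm v)\<^sup>2 \<le> v \<bullet> (B *v v) + K * (norm (S *v v))\<^sup>2"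
proof -
  define X :: "(real^'n) set" where "X = sphere 0 1"
  define q where "q v = v \<bullet> (B *v v)" for v
  define r where "r v = (norm (S *v v))\<^sup>2" for v
  have cq: "continuous_on U q" and cr: "continuous_on U r" for U
    unfolding q_def r_def by (intro continuous_intros)+
  have X: "compact X" "X \<noteq> {}" unfolding X_def by auto
  define Y where "Y = {v\<in>X. q v \<le> 0}"
  have "Y = X \<inter> q -` {..0}" by (auto simp: Y_def)
  moreover have "closed (X \<inter> q -` {..0})"
    using X compact_imp_closed by (intro continuous_closed_preimage cq) auto
  ultimately have "compact Y" using X compact_Int_closed[of X Y] by (simp add: Int_absorb1 Int_commute)
  obtain K where "K \<ge> 0" and K: "\<And>v. v \<in> X \<Longrightarrow> q v + K * r v > 0"
  proof (cases "Y = {}")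
    case True
    then show ?thesis by (intro that[of 0]) (auto simp: Y_def)
  next
    case False
    obtain v0 where v0: "v0 \<in> Y" "\<And>v. v \<in> Y \<Longrightarrow> r v0 \<le> r v"
      using continuous_attains_inf[OF \<open>compact Y\<close> False cr] by blast
    obtain v1 where v1: "\<And>v. v \<in> X \<Longrightarrow> q v1 \<le> q v"
      using continuous_attains_inf[OF X cq] by blast
    have "v0 \<noteq> 0" using v0(1) by (auto simp: Y_def X_def)
    then have "S *v v0 \<noteq> 0" using pos[of v0] v0(1) by (auto simp: Y_def q_def)
    then have r0: "r v0 > 0" by (simp add: r_def)
    show ?thesis
    proof (rule that)
      \<comment> \<open>With \<open>q v1\<close> the minimum of the form on the sphere and
        \<open>r v0\<close> that of the penalty on \<open>Y\<close>, this factor makes the penalty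
        on \<open>Y\<close> at least \<open>\<bar>q v1\<bar> + 1\<close>, more than the form can
        lose.\<close>
      show "(\<bar>q v1\<bar> + 1) / r v0 \<ge> 0" using r0 by simp
      fix v assume v: "v \<in> X"
      show "q v + (\<bar>q v1\<bar> + 1) / r v0 * r v > 0"
      proof (cases "v \<in> Y")
        case True
        have "\<bar>q v1\<bar> + 1 = (\<bar>q v1\<bar> + 1) / r v0 * r v0" using r0 by simp
        also have "\<dots> \<le> (\<bar>q v1\<bar> + 1) / r v0 * r v"
          using r0 v0(2)[OF True] by (intro mult_left_mono) auto
        finally show ?thesis using v1[OF v] by linarith
      next
        case False
        then have "q v > 0" using v by (simp add: Y_def)
        moreover have "(\<bar>q v1\<bar> + 1) / r v0 * r v \<ge> 0" using r0 by (simp add: r_def)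
        ultimately show ?thesis by linarith
      qed
    qed
  qed
  have "continuous_on X (\<lambda>v. q v + K * r v)" by (intro continuous_intros cq cr)
  then obtain v2 where v2: "v2 \<in> X" "\<And>v. v \<in> X \<Longrightarrow> q v2 + K * r v2 \<le> q v + K * r v"
    using continuous_attains_inf[OF X] by blast
  define \<gamma> where "\<gamma> = q v2 + K * r v2"
  have "\<gamma> * (norm v)\<^sup>2 \<le> q v + K * r v" for v
  proof (cases "v = 0")
    case True
    then show ?thesis by (simp add: q_def r_def)
  next
    case False
    define u where "u = (1 / norm v) *\<^sub>R v"
    have u: "u \<in> X" "v = norm v *\<^sub>R u" using False by (auto simp: u_def X_def)
    have "q (norm v *\<^sub>R u) = (norm v)\<^sup>2 * q u"
      by (simp add: q_def matrix_vector_mult_scaleR power2_eq_square)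
    moreover have "r (norm v *\<^sub>R u) = (norm v)\<^sup>2 * r u"
      by (simp add: r_def matrix_vector_mult_scaleR power_mult_distrib)
    ultimately have "q v + K * r v = (q u + K * r u) * (norm v)\<^sup>2"
      unfolding u(2)[symmetric] by (simp add: algebra_simps)
    then show ?thesis using v2(2)[OF u(1)] by (simp add: \<gamma>_def mult_right_mono)
  qed
  moreover have "\<gamma> > 0" using K v2(1) by (simp add: \<gamma>_def)
  ultimately show ?thesis using \<open>K \<ge> 0\<close> unfolding q_def r_def by blast
qed

lemma inner_matrix_transpose:
  fixes B :: "real^'n^'m"
  shows "(B *v u) \<bullet> w = u \<bullet> (transpose B *v w)"
proof -
  have "(B *v u) \<bullet> w = w \<bullet> (B *v u)" by (rule inner_commute)
  also have "\<dots> = (w v* B) \<bullet> u" by (rule dot_lmul_matrix[of w B u, symmetric])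
  also have "\<dots> = u \<bullet> (transpose B *v w)" by (simp add: inner_commute transpose_matrix_vector)
  finally show ?thesis .
qed

lemma tendsto_matrix_vector_mult [tendsto_intros]:
  fixes B :: "'z \<Rightarrow> real^'n^'m"
  assumes "(B \<longlongrightarrow> B0) F" "(u \<longlongrightarrow> u0) F"
  shows "((\<lambda>z. B z *v u z) \<longlongrightarrow> B0 *v u0) F"
  unfolding matrix_vector_mult_def by (intro tendsto_vec_lambda tendsto_sum tendsto_mult tendsto_vec_nth assms)

lemma tendsto_transpose [tendsto_intros]:
  fixes B :: "'z \<Rightarrow> real^'n^'m"
  assumes "(B \<longlongrightarrow> B0) F"
  shows "((\<lambda>z. transpose (B z)) \<longlongrightarrow> transpose B0) F"
  unfolding transpose_def by (intro tendsto_vec_lambda tendsto_vec_nth assms)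

lemma tendsto_matrix_matrix_mult [tendsto_intros]:
  fixes B :: "'z \<Rightarrow> real^'n^'m" and C :: "'z \<Rightarrow> real^'p^'n"
  assumes "(B \<longlongrightarrow> B0) F" "(C \<longlongrightarrow> C0) F"
  shows "((\<lambda>z. B z ** C z) \<longlongrightarrow> B0 ** C0) F"
  unfolding matrix_matrix_mult_def by (intro tendsto_vec_lambda tendsto_sum tendsto_mult tendsto_vec_nth assms)

text \<open>\<open>K\<close> is fixed at \<open>z0\<close>. The penalised form is written as
  \<open>v \<bullet> T z v\<close> with \<open>T z\<close> linear, so perturbation of
  \<open>T\<close> costs at most half of \<open>\<gamma>\<close>, simultaneously for all
  \<open>v\<close>.\<close>

lemma eventually_quadratic_form_penalty:
  fixes B :: "'z::topological_space \<Rightarrow> real^'n^'n" and S :: "'z \<Rightarrow> real^'n^'l"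
  assumes pos: "\<And>v. S z0 *v v = 0 \<Longrightarrow> v \<noteq> 0 \<Longrightarrow> v \<bullet> (B z0 *v v) > 0"
    and B: "(B \<longlongrightarrow> B z0) (nhds z0)" and S: "(S \<longlongrightarrow> S z0) (nhds z0)"
  shows "\<exists>K\<ge>0. \<exists>\<gamma>>0. \<forall>\<^sub>F z in nhds z0. \<forall>v. \<gamma> * (norm v)\<^sup>2 \<le> v \<bullet> (B z *v v) + K * (norm (S z *v v))\<^sup>2"
proof -
  obtain K \<gamma> where K: "K \<ge> 0" "\<gamma> > 0"
    "\<And>v. \<gamma> * (norm v)\<^sup>2 \<le> v \<bullet> (B z0 *v v) + K * (norm (S z0 *v v))\<^sup>2"
    using quadratic_form_penalty[of "S z0" "B z0"] pos by blast
  define T where "T z v = B z *v v + K *\<^sub>R (transpose (S z) *v (S z *v v))" for z v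
  have T: "v \<bullet> T z v = v \<bullet> (B z *v v) + K * (norm (S z *v v))\<^sup>2" for z v
    by (simp add: T_def inner_add_right power2_norm_eq_inner inner_matrix_transpose)
  have "\<forall>\<^sub>F z in nhds z0. \<forall>v. norm (T z v - T z0 v) \<le> \<gamma> / 2 * norm v"
  proof (rule linear_family_perturbation)
    show "linear (T z)" for z
      unfolding T_def by (intro linearI)
        (simp_all add: matrix_vector_right_distrib matrix_vector_mult_scaleR algebra_simps)
    show "((\<lambda>z. T z u) \<longlongrightarrow> T z0 u) (nhds z0)" for u
      unfolding T_def by (intro tendsto_intros B S)
  qed (use K in simp)
  then have "\<forall>\<^sub>F z in nhds z0. \<forall>v. \<gamma> / 2 * (norm v)\<^sup>2 \<le> v \<bullet> (B z *v v) + K * (norm (S z *v v))\<^sup>2"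
  proof eventually_elim
    case (elim z)
    show ?case
    proof
      fix v
      have "\<bar>v \<bullet> (T z v - T z0 v)\<bar> \<le> norm v * (\<gamma> / 2 * norm v)"
        by (rule order_trans[OF Cauchy_Schwarz_ineq2]) (intro mult_left_mono elim[rule_format] norm_ge_zero)
      then have "\<bar>v \<bullet> T z v - v \<bullet> T z0 v\<bar> \<le> \<gamma> / 2 * (norm v)\<^sup>2"
        by (simp add: inner_diff_right power2_eq_square algebra_simps)
      then show "\<gamma> / 2 * (norm v)\<^sup>2 \<le> v \<bullet> (B z *v v) + K * (norm (S z *v v))\<^sup>2"
        using K(3)[of v] T[of v z] T[of v z0] by linarith
    qed
  qed
  with K(1,2) show ?thesis by (intro exI[of _ K] conjI exI[of _ "\<gamma> / 2"]) auto
qed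

section \<open>PLQ functions near the active manifold\<close>

text \<open>Divide by \<open>t\<close> and let it tend to zero. This is the device by which the
  quadratic parts of the pieces drop out of every first-order comparison below.\<close>

lemma linear_dominated_by_quadratic_nonpos:
  fixes p r s :: real
  assumes "r > 0" and le: "\<And>t. 0 < t \<Longrightarrow> t < r \<Longrightarrow> t * p \<le> t\<^sup>2 * s"
  shows "p \<le> 0"
proof (rule tendsto_le)
  show "((\<lambda>t. t * s) \<longlongrightarrow> 0) (at_right 0)" by (auto intro!: tendsto_eq_intros)
  have "p \<le> t * s" if "0 < t" "t < r" for t
    using le[OF that] that by (simp add: power2_eq_square mult.assoc)
  then show "\<forall>\<^sub>F t in at_right 0. p \<le> t * s"
    using \<open>r > 0\<close> unfolding eventually_at_right_field by blast
qed auto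

lemma ball_contains_short_segment:
  fixes z v :: "'a::real_normed_vector"
  assumes "z \<in> ball p r"
  obtains e where "e > 0" "\<And>t. \<bar>t\<bar> < e \<Longrightarrow> z + t *\<^sub>R v \<in> ball p r"
proof -
  have "((\<lambda>t. z + t *\<^sub>R v) \<longlongrightarrow> z + 0 *\<^sub>R v) (nhds (0::real))"
    by (intro tendsto_intros filterlim_ident)
  then have "\<forall>\<^sub>F t in nhds (0::real). z + t *\<^sub>R v \<in> ball p r"
    by (rule topological_tendstoD) (use assms in auto)
  then show ?thesis using that unfolding eventually_nhds_metric by (auto simp: dist_real_def)
qed

section \<open>The Gram matrix of an injective matrix\<close>

context
  fixes A :: "real^'l^'m"
  assumes Null_A: "Null A = {0}"
begin

lemma gram_inverse:
  "matrix_inv (transpose A ** A) *v (transpose A *v (A *v u)) = u"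
  "transpose A *v (A *v (matrix_inv (transpose A ** A) *v u)) = u"
proof -
  have "v = 0" if "(transpose A ** A) *v v = 0" for v
  proof -
    have "(A *v v) \<bullet> (A *v v) = v \<bullet> ((transpose A ** A) *v v)"
      by (simp add: inner_matrix_transpose matrix_vector_mul_assoc)
    then show ?thesis using that Null_A by (auto simp: Null_def)
  qed
  then have "invertible (transpose A ** A)"
    by (simp add: invertible_left_inverse matrix_left_invertible_ker)
  then have "matrix_inv (transpose A ** A) ** (transpose A ** A) = mat 1"
    "(transpose A ** A) ** matrix_inv (transpose A ** A) = mat 1"
    unfolding invertible_def matrix_inv_def by (metis (mono_tags, lifting) someI_ex)+
  then show "matrix_inv (transpose A ** A) *v (transpose A *v (A *v u)) = u"
    "transpose A *v (A *v (matrix_inv (transpose A ** A) *v u)) = u"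
    by (simp_all add: matrix_vector_mul_assoc matrix_mul_assoc)
qed

text \<open>The hypothesis says that \<open>y\<close> is orthogonal to the kernel of
  \<open>transpose A\<close>, that is, lies in the range of \<open>A\<close>; the left-hand side is
  the orthogonal projection onto that range.\<close>

lemma gram_projection:
  assumes "\<And>v. transpose A *v v = 0 \<Longrightarrow> y \<bullet> v = 0"
  shows "A *v (matrix_inv (transpose A ** A) *v (transpose A *v y)) = y"
proof -
  define w where "w = A *v (matrix_inv (transpose A ** A) *v (transpose A *v y))"
  have null: "transpose A *v (y - w) = 0"
    by (simp add: matrix_vector_mult_diff_distrib w_def gram_inverse)
  have "w \<bullet> (y - w) = 0" unfolding w_def inner_matrix_transpose using null by (simp add: w_def)
  then have "(y - w) \<bullet> (y - w) = 0" using assms[OF null] by (simp add: inner_diff_left)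
  then show ?thesis by (simp add: w_def)
qed

end

text \<open>
  Near a point of the active manifold, a PLQ function is determined by the signed active
  hyperplanes, and the manifold is the affine set on which all of them are active.
\<close>

locale plq_chart =
  fixes h :: "real^'m \<Rightarrow> ereal" and Q :: "'k \<Rightarrow> real^'m^'m" and b :: "'k \<Rightarrow> real^'m" and \<beta> :: "'k \<Rightarrow> real"
    and \<kappa> :: "'b::finite \<Rightarrow> 'k" and A :: "real^'l^'m" and P :: "'b \<Rightarrow> real^'l^'l"
    and cbar :: "real^'m" and \<eta> :: real
  assumes convex: "convex_fun h" and not_minf: "\<And>z. h z \<noteq> -\<infinity>"
    and sym_Q: "\<And>i. transpose (Q (\<kappa> i)) = Q (\<kappa> i)"
    and P_diagonal: "\<And>i p q. p \<noteq> q \<Longrightarrow> P i $ p $ q = 0"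
    and P_signs: "\<And>i p. P i $ p $ p \<in> {1, -1}"
    and Null_A: "Null A = {0}"
    and \<eta>_pos: "\<eta> > 0"
    and piece_value: "\<And>z i. z \<in> ball cbar \<eta> \<Longrightarrow>
      (\<And>p. (transpose (A ** P i) *v (z - cbar)) $ p \<le> 0) \<Longrightarrow>
      h z = ereal (1/2 * (z \<bullet> (Q (\<kappa> i) *v z)) + b (\<kappa> i) \<bullet> z + \<beta> (\<kappa> i))"
    and piece_cover: "\<And>z. z \<in> ball cbar \<eta> \<Longrightarrow> h z < \<infinity> \<Longrightarrow>
      \<exists>i. \<forall>p. (transpose (A ** P i) *v (z - cbar)) $ p \<le> 0"
begin

text \<open>Stated as an affine slice of the ball instead of a relative interior, so that membership
  of a linearised point is the last Newton equation together with closeness to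
  \<open>cbar\<close>.\<close>

definition manifold :: "(real^'m) set" where
  "manifold = {z \<in> ball cbar \<eta>. transpose A *v z = transpose A *v cbar}"

abbreviation piece_grad :: "'b \<Rightarrow> real^'m \<Rightarrow> real^'m" where
  "piece_grad i z \<equiv> Q (\<kappa> i) *v z + b (\<kappa> i)"

lemma P_mult: "(P i *v u) $ p = P i $ p $ p * u $ p"
proof -
  have "(P i *v u) $ p = (\<Sum>q\<in>UNIV. P i $ p $ q * u $ q)"
    by (simp add: matrix_vector_mult_def)
  also have "\<dots> = (\<Sum>q\<in>{p}. P i $ p $ q * u $ q)"
    by (rule sum.mono_neutral_right) (auto simp: P_diagonal)
  finally show ?thesis by simp
qed

lemma P_involution [simp]: "P i *v (P i *v u) = u"
proof -
  have "P i $ p $ p * (P i $ p $ p * u $ p) = u $ p" for p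
    using P_signs[of i p] by auto
  then show ?thesis by (simp add: vec_eq_iff P_mult)
qed

lemma transpose_P: "transpose (P i) = P i"
proof -
  have "P i $ q $ p = P i $ p $ q" for p q by (cases "p = q") (auto simp: P_diagonal)
  then show ?thesis by (simp add: vec_eq_iff transpose_def)
qed

lemma transpose_AP: "transpose (A ** P i) *v v = P i *v (transpose A *v v)"
  by (simp add: matrix_transpose_mul transpose_P matrix_vector_mul_assoc)

lemma norm_P: "norm (P i *v u) = norm u"
proof -
  have "(P i *v u) \<bullet> (P i *v u) = u \<bullet> u"
    by (simp add: inner_matrix_transpose transpose_P)
  then show ?thesis by (simp add: norm_eq_sqrt_inner)
qed

lemma piece_expansion:
  assumes "z + v \<in> ball cbar \<eta>" "\<And>p. (transpose (A ** P i) *v (z + v - cbar)) $ p \<le> 0"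
    and "z \<in> ball cbar \<eta>" "\<And>p. (transpose (A ** P i) *v (z - cbar)) $ p \<le> 0"
  obtains r where "h z = ereal r"
    "h (z + v) = ereal (r + piece_grad i z \<bullet> v + 1/2 * (v \<bullet> (Q (\<kappa> i) *v v)))"
proof -
  have "z \<bullet> (Q (\<kappa> i) *v v) = v \<bullet> (Q (\<kappa> i) *v z)"
    using inner_matrix_transpose[of "Q (\<kappa> i)" z v] by (simp add: sym_Q inner_commute)
  then have "1/2 * ((z + v) \<bullet> (Q (\<kappa> i) *v (z + v))) + b (\<kappa> i) \<bullet> (z + v) + \<beta> (\<kappa> i)
      = (1/2 * (z \<bullet> (Q (\<kappa> i) *v z)) + b (\<kappa> i) \<bullet> z + \<beta> (\<kappa> i)) + piece_grad i z \<bullet> v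
        + 1/2 * (v \<bullet> (Q (\<kappa> i) *v v))"
    by (simp add: matrix_vector_right_distrib inner_add_left inner_add_right inner_commute[of "Q (\<kappa> i) *v z"])
  then show ?thesis
    using piece_value[OF assms(1,2)] piece_value[OF assms(3,4)] by (intro that) simp_all
qed

text \<open>Since \<open>transpose A *v (z - cbar)\<close> vanishes, whether \<open>z + v\<close>
  lies in a piece depends on the direction \<open>v\<close> only, and the condition is homogeneous
  in \<open>v\<close>.\<close>

lemma manifold_constraints:
  assumes "z \<in> manifold"
  shows "transpose (A ** P i) *v (z + v - cbar) = P i *v (transpose A *v v)"
  using assms by (simp add: transpose_AP manifold_def matrix_vector_mult_diff_distrib
      matrix_vector_right_distrib)

lemma manifold_piece_expansion:
  assumes z: "z \<in> manifold" and v: "z + v \<in> ball cbar \<eta>" "\<And>p. (P i *v (transpose A *v v)) $ p \<le> 0"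
  obtains r where "h z = ereal r"
    "h (z + v) = ereal (r + piece_grad i z \<bullet> v + 1/2 * (v \<bullet> (Q (\<kappa> i) *v v)))"
proof (rule piece_expansion)
  show "z + v \<in> ball cbar \<eta>" by (rule v(1))
  show "(transpose (A ** P i) *v (z + v - cbar)) $ p \<le> 0" for p
    using v(2) by (simp add: manifold_constraints[OF z])
  show "(transpose (A ** P i) *v (z - cbar)) $ p \<le> 0" for p
    using manifold_constraints[OF z, of i 0] by simp
  show "z \<in> ball cbar \<eta>" using z by (simp add: manifold_def)
qed (rule that)

lemma manifold_finite:
  assumes "z \<in> manifold"
  obtains r where "h z = ereal r"
  using manifold_piece_expansion[OF assms, of 0] assms by (auto simp: manifold_def)

text \<open>A tangential step keeps all active constraints equal to zero, so the segment lies in all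
  pieces at once; one radius serves every \<open>i\<close> and both signs of
  \<open>t\<close>.\<close>

lemma manifold_line_expansion:
  assumes z: "z \<in> manifold" "h z = ereal r" and v: "transpose A *v v = 0"
  obtains e where "e > 0" "\<And>t i. \<bar>t\<bar> < e \<Longrightarrow>
    h (z + t *\<^sub>R v) = ereal (r + t * (piece_grad i z \<bullet> v) + t\<^sup>2 / 2 * (v \<bullet> (Q (\<kappa> i) *v v)))"
proof -
  obtain e where e: "e > 0" "\<And>t. \<bar>t\<bar> < e \<Longrightarrow> z + t *\<^sub>R v \<in> ball cbar \<eta>"
    using ball_contains_short_segment[of z cbar \<eta> v] z(1) unfolding manifold_def by blast
  show ?thesis
  proof (rule that[OF e(1)])
    fix t :: real and i assume t: "\<bar>t\<bar> < e"
    obtain r' where "h z = ereal r'" "h (z + t *\<^sub>R v)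
        = ereal (r' + piece_grad i z \<bullet> (t *\<^sub>R v) + 1/2 * ((t *\<^sub>R v) \<bullet> (Q (\<kappa> i) *v (t *\<^sub>R v))))"
      by (rule manifold_piece_expansion[OF z(1) e(2)[OF t], of i]) (auto simp: matrix_vector_mult_scaleR v)
    with z(2) show "h (z + t *\<^sub>R v)
        = ereal (r + t * (piece_grad i z \<bullet> v) + t\<^sup>2 / 2 * (v \<bullet> (Q (\<kappa> i) *v v)))"
      by (simp add: matrix_vector_mult_scaleR power2_eq_square)
  qed
qed

text \<open>The quadratics of pieces \<open>i\<close> and \<open>j\<close> both equal
  \<open>h\<close> along a short tangential segment. Evaluating at \<open>e / 2\<close> and
  \<open>- (e / 2)\<close> and subtracting isolates the odd part, which is the linear
  coefficient.\<close>

lemma piece_grads_agree: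
  assumes z: "z \<in> manifold" and v: "transpose A *v v = 0"
  shows "piece_grad i z \<bullet> v = piece_grad j z \<bullet> v"
proof -
  obtain r where r: "h z = ereal r" using manifold_finite[OF z] .
  obtain e where e: "e > 0" "\<And>t i. \<bar>t\<bar> < e \<Longrightarrow>
    h (z + t *\<^sub>R v) = ereal (r + t * (piece_grad i z \<bullet> v) + t\<^sup>2 / 2 * (v \<bullet> (Q (\<kappa> i) *v v)))"
    using manifold_line_expansion[OF z r v] by blast
  have "t * (piece_grad i z \<bullet> v) + t\<^sup>2 / 2 * (v \<bullet> (Q (\<kappa> i) *v v))
      = t * (piece_grad j z \<bullet> v) + t\<^sup>2 / 2 * (v \<bullet> (Q (\<kappa> j) *v v))" if "\<bar>t\<bar> < e" for t
    using e(2)[OF that, of i] e(2)[OF that, of j] by simp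
  from this[of "e / 2"] this[of "- (e / 2)"] e(1)
  have "e * (piece_grad i z \<bullet> v) = e * (piece_grad j z \<bullet> v)"
    unfolding power2_minus by argo
  then show ?thesis using e(1) by simp
qed

text \<open>The subgradient inequality along \<open>v\<close> and along \<open>- v\<close> gives
  both inequalities, since \<open>h\<close> is a single quadratic on the tangential line near
  \<open>z\<close>.\<close>

lemma subgradient_tangential:
  assumes z: "z \<in> manifold" and v: "transpose A *v v = 0" and y: "y \<in> subdifferential h z"
  shows "y \<bullet> v = piece_grad i z \<bullet> v"
proof -
  obtain r where r: "h z = ereal r" using manifold_finite[OF z] .
  have le: "y \<bullet> v \<le> piece_grad i z \<bullet> v" if v': "transpose A *v v = 0" for v
  proof -
    obtain e where e: "e > 0" "\<And>t i. \<bar>t\<bar> < e \<Longrightarrow>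
      h (z + t *\<^sub>R v) = ereal (r + t * (piece_grad i z \<bullet> v) + t\<^sup>2 / 2 * (v \<bullet> (Q (\<kappa> i) *v v)))"
      using manifold_line_expansion[OF z r v'] by blast
    have "y \<bullet> v - piece_grad i z \<bullet> v \<le> 0"
    proof (rule linear_dominated_by_quadratic_nonpos[OF e(1)])
      fix t :: real assume t: "0 < t" "t < e"
      have "h z + ereal (y \<bullet> ((z + t *\<^sub>R v) - z)) \<le> h (z + t *\<^sub>R v)"
        using y unfolding subdifferential_def by blast
      then have "t * (y \<bullet> v) \<le> t * (piece_grad i z \<bullet> v) + t\<^sup>2 / 2 * (v \<bullet> (Q (\<kappa> i) *v v))"
        using e(2)[of t i] t r by simp
      then show "t * (y \<bullet> v - piece_grad i z \<bullet> v) \<le> t\<^sup>2 * (v \<bullet> (Q (\<kappa> i) *v v) / 2)"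
        by (simp add: algebra_simps)
    qed
    then show ?thesis by simp
  qed
  have "transpose A *v (- v) = 0" using v by (simp add: vec.neg)
  from le[OF v] le[OF this] show ?thesis by simp
qed

text \<open>For \<open>w\<close> in the domain, the segment from \<open>z\<close> towards
  \<open>w\<close> starts inside some piece \<open>i\<close>. Convexity bounds the slope of that
  piece by the chord slope \<open>s - r\<close>, and the multiplier term only lowers
  \<open>y \<bullet> v\<close>, being a nonnegative vector against nonpositive constraint
  values.\<close>

lemma represents_subgradient:
  assumes z: "z \<in> manifold" and rep: "represents Q b \<kappa> A P z y \<mu>" and \<mu>: "\<And>i p. \<mu> $ i $ p \<ge> 0"
  shows "y \<in> subdifferential h z"
proof -
  obtain r where r: "h z = ereal r" using manifold_finite[OF z] .
  have "h z + ereal (y \<bullet> (w - z)) \<le> h w" for w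
  proof (cases "h w")
    case (real s)
    define v where "v = w - z"
    obtain e where e: "e > 0" "\<And>t. \<bar>t\<bar> < e \<Longrightarrow> z + t *\<^sub>R v \<in> ball cbar \<eta>"
      using ball_contains_short_segment[of z cbar \<eta> v] z unfolding manifold_def by blast
    have conv: "h (z + t *\<^sub>R v) \<le> ereal ((1 - t) * r + t * s)" if "0 < t" "t < 1" for t
    proof -
      have "h ((1 - t) *\<^sub>R z + t *\<^sub>R w) \<le> ereal (1 - t) * h z + ereal t * h w"
        using convex that unfolding convex_fun_def by simp
      moreover have "(1 - t) *\<^sub>R z + t *\<^sub>R w = z + t *\<^sub>R v" by (simp add: v_def algebra_simps)
      ultimately show ?thesis by (simp add: r real)
    qed
    \<comment> \<open>One sample point suffices to choose the piece: by homogeneity of its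
      constraints at \<open>z\<close>, the piece containing \<open>z + t0 *\<^sub>R v\<close>
      contains the whole short segment.\<close>
    define t0 where "t0 = min (e / 2) (1 / 2)"
    have t0: "0 < t0" "t0 < 1" "\<bar>t0\<bar> < e" using e(1) by (auto simp: t0_def)
    have "h (z + t0 *\<^sub>R v) < \<infinity>" using conv[OF t0(1,2)] by (auto simp: less_top[symmetric] top_ereal_def)
    then obtain i where i: "\<And>p. (transpose (A ** P i) *v (z + t0 *\<^sub>R v - cbar)) $ p \<le> 0"
      using piece_cover[OF e(2)[OF t0(3)]] by blast
    have i': "(P i *v (transpose A *v v)) $ p \<le> 0" for p
      using i[of p] t0(1) by (simp add: manifold_constraints[OF z] matrix_vector_mult_scaleR mult_le_0_iff)
    have "piece_grad i z \<bullet> v - (s - r) \<le> 0"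
    proof (rule linear_dominated_by_quadratic_nonpos)
      show "min e 1 > 0" using e(1) by simp
      fix t :: real assume t: "0 < t" "t < min e 1"
      have tb: "z + t *\<^sub>R v \<in> ball cbar \<eta>" using e(2)[of t] t by simp
      obtain r' where "h z = ereal r'" "h (z + t *\<^sub>R v)
          = ereal (r' + piece_grad i z \<bullet> (t *\<^sub>R v) + 1/2 * ((t *\<^sub>R v) \<bullet> (Q (\<kappa> i) *v (t *\<^sub>R v))))"
        using manifold_piece_expansion[OF z tb, of i] i' t
        by (auto simp: matrix_vector_mult_scaleR mult_le_0_iff)
      then have "r + t * (piece_grad i z \<bullet> v) + t\<^sup>2 / 2 * (v \<bullet> (Q (\<kappa> i) *v v)) \<le> (1 - t) * r + t * s"
        using conv[of t] t r by (simp add: matrix_vector_mult_scaleR power2_eq_square)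
      then show "t * (piece_grad i z \<bullet> v - (s - r)) \<le> t\<^sup>2 * (- (v \<bullet> (Q (\<kappa> i) *v v)) / 2)"
        by (simp add: algebra_simps)
    qed
    moreover have "((A ** P i) *v \<mu> $ i) \<bullet> v \<le> 0"
      unfolding inner_matrix_transpose transpose_AP unfolding inner_vec_def
      using i' \<mu> by (intro sum_nonpos) (simp add: mult_nonneg_nonpos)
    moreover have "y = piece_grad i z + (A ** P i) *v \<mu> $ i" using rep by (simp add: represents_def)
    ultimately have "y \<bullet> v \<le> s - r" by (simp add: inner_add_left)
    then show ?thesis by (simp add: r real v_def)
  qed (use not_minf in auto)
  then show ?thesis by (simp add: subdifferential_def effective_dom_def r)
qed

text \<open>Left multiplication by the pseudo-inverse of \<open>A\<close> and then by the involution
  \<open>P i\<close> recovers each block. Neither signs nor membership in the manifold enter, so any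
  admissible multiplier vector must be given by the explicit formula.\<close>

lemma represents_unique:
  assumes "represents Q b \<kappa> A P z y \<mu>"
  shows "\<mu> = multiplier Q b \<kappa> A P z y"
proof -
  have "\<mu> $ i = multiplier Q b \<kappa> A P z y $ i" for i
  proof -
    have "y - Q (\<kappa> i) *v z - b (\<kappa> i) = A *v (P i *v \<mu> $ i)"
      using assms unfolding represents_def matrix_vector_mul_assoc
      by (metis add_diff_cancel_left' diff_diff_eq)
    then show ?thesis by (simp add: multiplier_def gram_inverse[OF Null_A])
  qed
  then show ?thesis by (simp add: vec_eq_iff)
qed

text \<open>Agreement of \<open>y\<close> with one piece \<open>j\<close> on tangential directions
  passes to all pieces by \<open>piece_grads_agree\<close>; each difference
  \<open>y - piece_grad i z\<close> then lies in the range of \<open>A\<close>, where the projection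
  formula is exact.\<close>

lemma represents_multiplier:
  assumes z: "z \<in> manifold" and y: "\<And>v. transpose A *v v = 0 \<Longrightarrow> y \<bullet> v = piece_grad j z \<bullet> v"
  shows "represents Q b \<kappa> A P z y (multiplier Q b \<kappa> A P z y)"
  unfolding represents_def
proof
  fix i
  have "A *v (matrix_inv (transpose A ** A) *v (transpose A *v (y - Q (\<kappa> i) *v z - b (\<kappa> i))))
      = y - Q (\<kappa> i) *v z - b (\<kappa> i)"
  proof (rule gram_projection[OF Null_A])
    fix v assume v: "transpose A *v v = 0"
    show "(y - Q (\<kappa> i) *v z - b (\<kappa> i)) \<bullet> v = 0"
      using y[OF v] piece_grads_agree[OF z v, of i j] by (simp add: inner_diff_left inner_add_left)
  qed
  then show "y = piece_grad i z + (A ** P i) *v multiplier Q b \<kappa> A P z y $ i"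
    by (simp add: multiplier_def matrix_vector_mul_assoc[symmetric])
qed

lemma tendsto_multiplier:
  assumes "(f \<longlongrightarrow> z) F" "(g \<longlongrightarrow> y) F"
  shows "((\<lambda>u. multiplier Q b \<kappa> A P (f u) (g u)) \<longlongrightarrow> multiplier Q b \<kappa> A P z y) F"
  unfolding multiplier_def
  by (intro tendsto_vec_lambda tendsto_matrix_vector_mult tendsto_diff tendsto_const assms)

text \<open>Positivity of the multipliers is an open condition in \<open>y\<close>, and every point
  of the affine hull of the subdifferential has the right tangential part, hence a multiplier
  representation; nearby points of the hull are therefore subgradients.\<close>

lemma represents_rel_interior:
  assumes z: "z \<in> manifold" and rep: "represents Q b \<kappa> A P z y \<mu>" and \<mu>: "\<And>i p. \<mu> $ i $ p > 0"
  shows "y \<in> rel_interior (subdifferential h z)"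
proof -
  have y: "y \<in> subdifferential h z" using represents_subgradient[OF z rep] \<mu> less_imp_le by blast
  have \<mu>_eq: "multiplier Q b \<kappa> A P z y = \<mu>" using represents_unique[OF rep] by simp
  have "\<forall>\<^sub>F y' in nhds y. \<forall>i p. multiplier Q b \<kappa> A P z y' $ i $ p > 0"
  proof (intro eventually_all_finite)
    fix i p
    have "((\<lambda>y'. multiplier Q b \<kappa> A P z y' $ i $ p) \<longlongrightarrow> multiplier Q b \<kappa> A P z y $ i $ p) (nhds y)"
      by (intro tendsto_vec_nth tendsto_multiplier tendsto_const filterlim_ident)
    then show "\<forall>\<^sub>F y' in nhds y. multiplier Q b \<kappa> A P z y' $ i $ p > 0"
      using \<mu> by (auto simp: \<mu>_eq dest: order_tendstoD)
  qed
  then obtain e where e: "e > 0" "\<And>y'. dist y' y < e \<Longrightarrow> \<forall>i p. multiplier Q b \<kappa> A P z y' $ i $ p > 0"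
    unfolding eventually_nhds_metric by blast
  \<comment> \<open>\<open>undefined\<close> is just some index of an active piece; by
    \<open>piece_grads_agree\<close> the flat is the same for every choice.\<close>
  have "affine hull subdifferential h z
      \<subseteq> {y'. \<forall>v. transpose A *v v = 0 \<longrightarrow> y' \<bullet> v = piece_grad undefined z \<bullet> v}"
  proof (rule hull_minimal)
    show "subdifferential h z
      \<subseteq> {y'. \<forall>v. transpose A *v v = 0 \<longrightarrow> y' \<bullet> v = piece_grad undefined z \<bullet> v}"
      using subgradient_tangential[OF z] by blast
    show "affine {y'. \<forall>v. transpose A *v v = 0 \<longrightarrow> y' \<bullet> v = piece_grad undefined z \<bullet> v}"
      unfolding affine_def by (auto simp: inner_add_left simp flip: distrib_right)
  qed
  moreover have "y' \<in> subdifferential h z"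
    if "dist y' y < e" "\<And>v. transpose A *v v = 0 \<Longrightarrow> y' \<bullet> v = piece_grad undefined z \<bullet> v" for y'
    by (rule represents_subgradient[OF z represents_multiplier[OF z that(2)]])
      (use e(2)[OF that(1)] less_imp_le in auto)
  ultimately have "ball y e \<inter> affine hull subdifferential h z \<subseteq> subdifferential h z"
    by (auto simp: dist_commute)
  then show ?thesis using y e(1) by (auto simp: mem_rel_interior_ball)
qed

text \<open>
  If the hyperplane \<open>p\<close> were inactive at \<open>z\<close>, one could move from \<open>z\<close> inside the piece
  \<open>i\<close> towards it; along such a direction \<open>h\<close> has slope smaller than the subgradient by \<open>\<mu> i p > 0\<close>.
\<close>

lemma positive_multiplier_manifold:
  assumes z: "z \<in> ball cbar \<eta>" and y: "y \<in> subdifferential h z"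
    and rep: "represents Q b \<kappa> A P z y \<mu>" and \<mu>: "\<And>i p. \<mu> $ i $ p > 0"
  shows "z \<in> manifold"
proof -
  have "h z < \<infinity>" using y by (simp add: subdifferential_def effective_dom_def)
  then obtain i where i: "\<And>p. (transpose (A ** P i) *v (z - cbar)) $ p \<le> 0"
    using piece_cover[OF z] by blast
  have "(transpose (A ** P i) *v (z - cbar)) $ p = 0" for p
  proof (rule ccontr)
    assume "(transpose (A ** P i) *v (z - cbar)) $ p \<noteq> 0"
    then have p: "(transpose (A ** P i) *v (z - cbar)) $ p < 0" using i[of p] by simp
    \<comment> \<open>Injectivity of \<open>A\<close> makes its transpose surjective: this
      \<open>v\<close> changes constraint \<open>p\<close> of piece \<open>i\<close> at unit rate
      and no other active constraint.\<close>
    define v where "v = A *v (matrix_inv (transpose A ** A) *v (P i *v axis p 1))"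
    have v: "transpose (A ** P i) *v v = axis p 1"
      by (simp add: transpose_AP v_def gram_inverse(2)[OF Null_A])
    obtain e where e: "e > 0" "\<And>t. \<bar>t\<bar> < e \<Longrightarrow> z + t *\<^sub>R v \<in> ball cbar \<eta>"
      using ball_contains_short_segment[OF z, of v] by blast
    \<comment> \<open>The second bound is the slack of constraint \<open>p\<close>, so the step does
      not leave piece \<open>i\<close>.\<close>
    define e' where "e' = min e (- (transpose (A ** P i) *v (z - cbar)) $ p)"
    have "\<mu> $ i $ p \<le> 0"
    proof (rule linear_dominated_by_quadratic_nonpos)
      show "e' > 0" using e(1) p by (simp add: e'_def)
      fix t :: real assume t: "0 < t" "t < e'"
      have tb: "z + t *\<^sub>R v \<in> ball cbar \<eta>" using e(2)[of t] t by (simp add: e'_def)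
      have "transpose (A ** P i) *v (z + t *\<^sub>R v - cbar) = transpose (A ** P i) *v (z - cbar) + t *\<^sub>R axis p 1"
        unfolding v[symmetric]
        by (simp add: matrix_vector_mult_diff_distrib matrix_vector_right_distrib matrix_vector_mult_scaleR)
      then have "(transpose (A ** P i) *v (z + t *\<^sub>R v - cbar)) $ q \<le> 0" for q
        using i[of q] t by (cases "q = p") (auto simp: e'_def axis_def)
      from piece_expansion[OF tb this z i] obtain r where r: "h z = ereal r" "h (z + t *\<^sub>R v)
          = ereal (r + piece_grad i z \<bullet> (t *\<^sub>R v) + 1/2 * ((t *\<^sub>R v) \<bullet> (Q (\<kappa> i) *v (t *\<^sub>R v))))"
        by blast
      have "h z + ereal (y \<bullet> ((z + t *\<^sub>R v) - z)) \<le> h (z + t *\<^sub>R v)"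
        using y unfolding subdifferential_def by blast
      then have "t * (y \<bullet> v) \<le> t * (piece_grad i z \<bullet> v) + t\<^sup>2 / 2 * (v \<bullet> (Q (\<kappa> i) *v v))"
        using r by (simp add: matrix_vector_mult_scaleR power2_eq_square)
      moreover have "y \<bullet> v = piece_grad i z \<bullet> v + \<mu> $ i $ p"
      proof -
        have "y = piece_grad i z + (A ** P i) *v \<mu> $ i" using rep by (simp add: represents_def)
        moreover have "((A ** P i) *v \<mu> $ i) \<bullet> v = \<mu> $ i $ p"
          by (simp add: inner_matrix_transpose v inner_axis)
        ultimately show ?thesis by (simp add: inner_add_left)
      qed
      ultimately show "t * \<mu> $ i $ p \<le> t\<^sup>2 * ((v \<bullet> (Q (\<kappa> i) *v v)) / 2)"
        by (simp add: algebra_simps)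
    qed
    with \<mu>[of i p] show False by simp
  qed
  then have "P i *v (transpose A *v (z - cbar)) = 0" by (simp add: vec_eq_iff transpose_AP)
  then have "transpose A *v (z - cbar) = 0" by (metis P_involution matrix_vector_mult_0_right)
  then show ?thesis using z by (simp add: manifold_def matrix_vector_mult_diff_distrib)
qed

text \<open>Along a tangential direction \<open>h\<close> is exactly quadratic near
  \<open>z\<close>, so both limits exist and the second quotient is eventually constant. The result
  holds for every \<open>i\<close>, which turns the second-order condition into one matrix
  inequality per active piece.\<close>

lemma second_dir_deriv_tangential:
  assumes z: "z \<in> manifold" and w: "transpose A *v w = 0"
  shows "second_dir_deriv h z w = ereal (w \<bullet> (Q (\<kappa> i) *v w))"
proof -
  obtain r where r: "h z = ereal r" using manifold_finite[OF z] .
  define g s where "g = piece_grad i z \<bullet> w" and "s = w \<bullet> (Q (\<kappa> i) *v w)"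
  obtain e where e: "e > 0" "\<And>t. \<bar>t\<bar> < e \<Longrightarrow> h (z + t *\<^sub>R w) = ereal (r + t * g + t\<^sup>2 / 2 * s)"
    using manifold_line_expansion[OF z r w] unfolding g_def s_def by metis
  have near: "\<forall>\<^sub>F t in at_right 0. 0 < t \<and> h (z + t *\<^sub>R w) = ereal (r + t * g + t\<^sup>2 / 2 * s)"
    unfolding eventually_at_right_field using e by (intro exI[of _ e]) auto
  have "((\<lambda>t. (h (z + t *\<^sub>R w) - h z) / ereal t) \<longlongrightarrow> ereal g) (at_right 0)"
  proof (rule Lim_transform_eventually)
    have "((\<lambda>t. g + t / 2 * s) \<longlongrightarrow> g + 0 / 2 * s) (at_right 0)" by (intro tendsto_intros) simp
    then show "((\<lambda>t. ereal (g + t / 2 * s)) \<longlongrightarrow> ereal g) (at_right 0)" by simp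
    show "\<forall>\<^sub>F t in at_right 0. ereal (g + t / 2 * s) = (h (z + t *\<^sub>R w) - h z) / ereal t"
      using near by eventually_elim (auto simp: r field_simps power2_eq_square)
  qed
  then have d: "dir_deriv h z w = ereal g" unfolding dir_deriv_def by (intro tendsto_Lim) auto
  have "((\<lambda>t. (h (z + t *\<^sub>R w) - h z - ereal t * dir_deriv h z w) / ereal (t\<^sup>2 / 2)) \<longlongrightarrow> ereal s) (at_right 0)"
  proof (rule Lim_transform_eventually)
    show "\<forall>\<^sub>F t in at_right 0.
        ereal s = (h (z + t *\<^sub>R w) - h z - ereal t * dir_deriv h z w) / ereal (t\<^sup>2 / 2)"
      using near by eventually_elim (auto simp: r d field_simps)
  qed simp
  then show ?thesis unfolding second_dir_deriv_def s_def by (intro tendsto_Lim) auto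
qed

text \<open>With \<open>v = w - d\<close>, let \<open>i\<close> be a piece containing the shifted
  point and \<open>s\<close> its vector of constraint values, so \<open>s \<le> 0\<close>
  componentwise. Stationarity cancels all first-order terms except
  \<open>- (\<mu> $ i \<bullet> s)\<close>, which is nonnegative and linear in \<open>s\<close>; it
  absorbs the loss \<open>K / 2 * (norm s)\<^sup>2\<close> from the growth bound and leaves the
  modulus \<open>\<gamma> / 2\<close>.\<close>

lemma strong_local_minimizer_model:
  fixes J :: "real^'n^'m" and H :: "real^'n^'n"
  assumes z: "c0 + J *v d \<in> manifold" and rep: "represents Q b \<kappa> A P (c0 + J *v d) y \<mu>"
    and \<mu>: "\<And>i p. \<mu> $ i $ p > 0"
    and symH: "transpose H = H" and stat: "H *v d + transpose J *v y = 0"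
    and "\<gamma> > 0" "K \<ge> 0"
    and growth: "\<And>i v. \<gamma> * (norm v)\<^sup>2
      \<le> v \<bullet> ((transpose J ** Q (\<kappa> i) ** J + H) *v v) + K * (norm ((transpose A ** J) *v v))\<^sup>2"
  shows "strong_local_minimizer (\<lambda>u. h (c0 + J *v u) + ereal (1/2 * (u \<bullet> (H *v u)))) d"
proof -
  define z where "z = c0 + J *v d"
  have zM: "z \<in> manifold" and rep: "represents Q b \<kappa> A P z y \<mu>" using z rep by (simp_all add: z_def)
  obtain r where r: "h z = ereal r" using manifold_finite[OF zM] .
  define m where "m = Min (range (\<lambda>(i, p). \<mu> $ i $ p))"
  have "m \<in> range (\<lambda>(i, p). \<mu> $ i $ p)" unfolding m_def by (intro Min_in) auto
  then have m_pos: "m > 0" using \<mu> by auto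
  have m_le: "m \<le> \<mu> $ i $ p" for i p unfolding m_def by (intro Min_le) auto
  have "((\<lambda>w. z + J *v (w - d)) \<longlongrightarrow> z + J *v (d - d)) (nhds d)"
    by (intro tendsto_intros filterlim_ident)
  then have ev1: "\<forall>\<^sub>F w in nhds d. z + J *v (w - d) \<in> ball cbar \<eta>"
    by (rule topological_tendstoD) (use zM in \<open>auto simp: manifold_def\<close>)
  have "((\<lambda>w. K * norm ((transpose A ** J) *v (w - d))) \<longlongrightarrow> K * norm ((transpose A ** J) *v (d - d))) (nhds d)"
    by (intro tendsto_intros filterlim_ident)
  \<comment> \<open>The threshold \<open>2 * m\<close> is where
    \<open>K / 2 * (norm s)\<^sup>2\<close> equals \<open>m * norm s\<close>, with \<open>m\<close>
    the smallest multiplier.\<close>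
  then have ev2: "\<forall>\<^sub>F w in nhds d. K * norm ((transpose A ** J) *v (w - d)) < 2 * m"
    by (rule order_tendstoD) (use m_pos in simp)
  have "\<forall>\<^sub>F w in nhds d. h (c0 + J *v w) < \<infinity> \<longrightarrow>
      h z + ereal (1/2 * (d \<bullet> (H *v d))) + ereal (\<gamma> / 2 * (norm (w - d))\<^sup>2)
      \<le> h (c0 + J *v w) + ereal (1/2 * (w \<bullet> (H *v w)))"
    using ev1 ev2
  proof eventually_elim
    case (elim w)
    define v where "v = w - d"
    have w: "c0 + J *v w = z + J *v v" by (simp add: z_def v_def matrix_vector_mult_diff_distrib)
    show ?case
    proof
      assume "h (c0 + J *v w) < \<infinity>"
      then obtain i where "\<And>p. (transpose (A ** P i) *v (z + J *v v - cbar)) $ p \<le> 0"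
        using piece_cover[of "z + J *v v"] elim(1) by (auto simp: w v_def)
      then have i: "(P i *v (transpose A *v (J *v v))) $ p \<le> 0" for p
        by (simp add: manifold_constraints[OF zM])
      define s where "s = P i *v (transpose A *v (J *v v))"
      obtain r' where "h z = ereal r'" "h (z + J *v v)
          = ereal (r' + piece_grad i z \<bullet> (J *v v) + 1/2 * ((J *v v) \<bullet> (Q (\<kappa> i) *v (J *v v))))"
        using manifold_piece_expansion[OF zM, of "J *v v" i] elim(1) i by (auto simp: v_def)
      then have hz: "h (z + J *v v)
          = ereal (r + piece_grad i z \<bullet> (J *v v) + 1/2 * ((J *v v) \<bullet> (Q (\<kappa> i) *v (J *v v))))"
        using r by simp
      have "y = piece_grad i z + (A ** P i) *v \<mu> $ i" using rep by (simp add: represents_def)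
      then have "y \<bullet> (J *v v) = piece_grad i z \<bullet> (J *v v) + \<mu> $ i \<bullet> s"
        by (simp add: inner_add_left inner_matrix_transpose transpose_AP s_def)
      moreover have "y \<bullet> (J *v v) = - ((H *v d) \<bullet> v)"
      proof -
        have "y \<bullet> (J *v v) = v \<bullet> (transpose J *v y)"
          using inner_matrix_transpose[of J v y] by (simp add: inner_commute)
        also have "transpose J *v y = - (H *v d)" using stat by (simp add: add_eq_0_iff)
        finally show ?thesis by (simp add: inner_commute)
      qed
      moreover have "w \<bullet> (H *v w) = d \<bullet> (H *v d) + 2 * ((H *v d) \<bullet> v) + v \<bullet> (H *v v)"
      proof -
        have "d \<bullet> (H *v v) = (H *v d) \<bullet> v" by (simp add: inner_matrix_transpose symH)
        moreover have "w = d + v" by (simp add: v_def)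
        ultimately show ?thesis
          by (simp add: matrix_vector_right_distrib inner_add_left inner_add_right inner_commute)
      qed
      moreover have "v \<bullet> ((transpose J ** Q (\<kappa> i) ** J + H) *v v)
          = (J *v v) \<bullet> (Q (\<kappa> i) *v (J *v v)) + v \<bullet> (H *v v)"
        by (simp add: matrix_vector_mult_add_rdistrib inner_add_right inner_matrix_transpose
            flip: matrix_vector_mul_assoc)
      \<comment> \<open>All components of \<open>s\<close> have one sign, so
        \<open>- (\<mu> $ i \<bullet> s)\<close> is at least \<open>m\<close> times the 1-norm of
        \<open>s\<close>, and hence at least \<open>m * norm s\<close>.\<close>
      moreover have "\<mu> $ i \<bullet> s + K / 2 * (norm s)\<^sup>2 \<le> 0"
      proof -
        have "K * norm s \<le> 2 * m"
          using elim(2) by (simp add: s_def norm_P v_def flip: matrix_vector_mul_assoc)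
        then have "K / 2 * norm s * norm s \<le> m * norm s" by (intro mult_right_mono) auto
        also have "\<dots> \<le> m * (\<Sum>p\<in>UNIV. \<bar>s $ p\<bar>)"
          using m_pos by (intro mult_left_mono norm_le_l1_cart) auto
        also have "\<dots> = (\<Sum>p\<in>UNIV. m * \<bar>s $ p\<bar>)" by (rule sum_distrib_left)
        also have "\<dots> \<le> (\<Sum>p\<in>UNIV. - (\<mu> $ i $ p * s $ p))"
        proof (rule sum_mono)
          fix p
          have "s $ p \<le> 0" using i by (simp add: s_def)
          then show "m * \<bar>s $ p\<bar> \<le> - (\<mu> $ i $ p * s $ p)"
            using mult_right_mono_neg[OF m_le[of i p], of "s $ p"] by simp
        qed
        also have "\<dots> = - (\<mu> $ i \<bullet> s)" by (simp add: inner_vec_def sum_negf)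
        finally show ?thesis by (simp add: power2_eq_square)
      qed
      moreover have "norm ((transpose A ** J) *v v) = norm s"
        by (simp add: s_def norm_P flip: matrix_vector_mul_assoc)
      ultimately have "r + 1/2 * (d \<bullet> (H *v d)) + \<gamma> / 2 * (norm v)\<^sup>2
          \<le> r + piece_grad i z \<bullet> (J *v v) + 1/2 * ((J *v v) \<bullet> (Q (\<kappa> i) *v (J *v v))) + 1/2 * (w \<bullet> (H *v w))"
        using growth[of v i] by (simp only:) argo
      then show "h z + ereal (1/2 * (d \<bullet> (H *v d))) + ereal (\<gamma> / 2 * (norm (w - d))\<^sup>2)
          \<le> h (c0 + J *v w) + ereal (1/2 * (w \<bullet> (H *v w)))"
        unfolding w hz r v_def[symmetric] by simp
    qed
  qed
  moreover have "h (c0 + J *v w) < \<infinity>" if "h (c0 + J *v w) + ereal t < \<infinity>" for w t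
    using that by (cases "h (c0 + J *v w)") auto
  ultimately have "\<forall>\<^sub>F w in nhds d. h (c0 + J *v w) + ereal (1/2 * (w \<bullet> (H *v w))) < \<infinity> \<longrightarrow>
      h z + ereal (1/2 * (d \<bullet> (H *v d))) + ereal (\<gamma> / 2 * (norm (w - d))\<^sup>2)
      \<le> h (c0 + J *v w) + ereal (1/2 * (w \<bullet> (H *v w)))"
    by (auto elim!: eventually_mono)
  then show ?thesis
    unfolding strong_local_minimizer_def effective_dom_def
    using \<open>\<gamma> > 0\<close> by (auto simp: r r[unfolded z_def] intro!: exI[of _ "\<gamma> / 2"])
qed

text \<open>Moving \<open>y\<close> within the range of \<open>A\<close> leaves its tangential part
  unchanged, so the representation persists, and for small \<open>t\<close> the multipliers stay
  positive by continuity.\<close>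

lemma rel_interior_shift:
  assumes z: "z \<in> manifold" and rep: "represents Q b \<kappa> A P z y \<mu>" and \<mu>: "\<And>i p. \<mu> $ i $ p > 0"
  shows "\<exists>t>0. y + t *\<^sub>R (A *v u) \<in> rel_interior (subdifferential h z)"
proof -
  have \<mu>_eq: "multiplier Q b \<kappa> A P z y = \<mu>" using represents_unique[OF rep] by simp
  have "\<forall>\<^sub>F t in at_right 0. \<forall>i p. multiplier Q b \<kappa> A P z (y + t *\<^sub>R (A *v u)) $ i $ p > 0"
  proof (intro eventually_all_finite)
    fix i p
    have "((\<lambda>t. multiplier Q b \<kappa> A P z (y + t *\<^sub>R (A *v u)) $ i $ p)
        \<longlongrightarrow> multiplier Q b \<kappa> A P z (y + 0 *\<^sub>R (A *v u)) $ i $ p) (at_right 0)"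
      by (intro tendsto_vec_nth tendsto_multiplier tendsto_intros)
    then show "\<forall>\<^sub>F t in at_right 0. multiplier Q b \<kappa> A P z (y + t *\<^sub>R (A *v u)) $ i $ p > 0"
      by (rule order_tendstoD) (use \<mu> \<mu>_eq in simp)
  qed
  then have "\<forall>\<^sub>F t in at_right (0::real). 0 < t \<and>
      (\<forall>i p. multiplier Q b \<kappa> A P z (y + t *\<^sub>R (A *v u)) $ i $ p > 0)"
    by (intro eventually_conj eventually_at_right_less)
  then obtain t :: real where t: "t > 0"
    "\<And>i p. multiplier Q b \<kappa> A P z (y + t *\<^sub>R (A *v u)) $ i $ p > 0"
    using eventually_happens'[OF trivial_limit_at_right_real] by blast
  have "y \<in> subdifferential h z" using represents_subgradient[OF z rep] \<mu> less_imp_le by blast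
  then have "(y + t *\<^sub>R (A *v u)) \<bullet> v = piece_grad undefined z \<bullet> v" if "transpose A *v v = 0" for v
    using subgradient_tangential[OF z that] that by (simp add: inner_add_left inner_matrix_transpose)
  from represents_rel_interior[OF z represents_multiplier[OF z this] t(2)] t(1)
  show ?thesis by blast
qed

end

section \<open>From a PLQ representation to a chart\<close>

lemma transpose_mult_component: "(transpose B *v v) $ p = column p B \<bullet> (v :: real^'m)"
  by (simp add: matrix_vector_mult_def transpose_def column_def inner_vec_def)

text \<open>The radius is small enough that pieces missing \<open>cbar\<close> (closed sets) stay
  away and that inactive hyperplanes remain strictly on their side; only the active hyperplanes then
  decide membership in a piece. Being in the relative interior forces all active constraints to be
  equalities on the whole intersection \<open>D\<close>.\<close>

lemma plq_chart_exists:
  fixes h :: "real^'m \<Rightarrow> ereal" and \<kappa> :: "'b::finite \<Rightarrow> 'k::finite" and \<sigma> :: "'l::finite \<Rightarrow> 'j::finite"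
    and A :: "real^'l^'m" and P :: "'b \<Rightarrow> real^'l^'l"
  assumes plq: "plq_representation h Q b \<beta> a \<alpha> \<omega>"
    and enum_pieces: "bij_betw \<kappa> UNIV (active_pieces a \<alpha> \<omega> cbar)"
    and M: "M = rel_interior (\<Inter>k\<in>active_pieces a \<alpha> \<omega> cbar. piece a \<alpha> \<omega> k)"
    and cbar_M: "cbar \<in> M"
    and enum_active: "bij_betw \<sigma> UNIV (active_hyperplanes a \<alpha> cbar)"
    and P_diagonal: "\<And>i p q. p \<noteq> q \<Longrightarrow> P i $ p $ q = 0"
    and P_signs: "\<And>i p. P i $ p $ p \<in> {1, -1}"
    and AP_columns: "\<And>i p. column p (A ** P i) = \<omega> (\<kappa> i) (\<sigma> p) *\<^sub>R a (\<sigma> p)"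
    and Null_A: "Null A = {0}"
  obtains \<eta> where "plq_chart h Q b \<beta> \<kappa> A P cbar \<eta>"
    "\<And>z. z \<in> M \<Longrightarrow> transpose A *v z = transpose A *v cbar"
    "plq_chart.manifold A cbar \<eta> \<subseteq> M"
proof -
  have active: "cbar \<in> piece a \<alpha> \<omega> k \<longleftrightarrow> k \<in> range \<kappa>" for k
    using enum_pieces by (auto simp: bij_betw_def active_pieces_def)
  have \<sigma>: "a j \<bullet> cbar = \<alpha> j \<longleftrightarrow> j \<in> range \<sigma>" for j
    using enum_active by (auto simp: bij_betw_def active_hyperplanes_def)
  have \<omega>: "\<omega> k j \<in> {1, -1}" for k j using plq by (simp add: plq_representation_def)
  have "\<forall>\<^sub>F z in nhds cbar. cbar \<notin> piece a \<alpha> \<omega> k \<longrightarrow> z \<notin> piece a \<alpha> \<omega> k" for k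
  proof (cases "cbar \<in> piece a \<alpha> \<omega> k")
    case False
    have "piece a \<alpha> \<omega> k = (\<Inter>j. {z. (\<omega> k j *\<^sub>R a j) \<bullet> z \<le> \<omega> k j * \<alpha> j})" by (auto simp: piece_def)
    then have "closed (piece a \<alpha> \<omega> k)" by (simp only:) (intro closed_INT ballI closed_halfspace_le)
    then have "open (- piece a \<alpha> \<omega> k)" by blast
    with False show ?thesis unfolding eventually_nhds by (intro exI[of _ "- piece a \<alpha> \<omega> k"]) auto
  qed simp
  moreover have "\<forall>\<^sub>F z in nhds cbar. a j \<bullet> cbar \<noteq> \<alpha> j \<longrightarrow> (\<omega> (\<kappa> i) j *\<^sub>R a j) \<bullet> z < \<omega> (\<kappa> i) j * \<alpha> j" for i j
  proof (cases "a j \<bullet> cbar = \<alpha> j")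
    case False
    have "cbar \<in> piece a \<alpha> \<omega> (\<kappa> i)" by (simp add: active)
    then have "(\<omega> (\<kappa> i) j *\<^sub>R a j) \<bullet> cbar \<le> \<omega> (\<kappa> i) j * \<alpha> j" unfolding piece_def by blast
    with False have "(\<omega> (\<kappa> i) j *\<^sub>R a j) \<bullet> cbar < \<omega> (\<kappa> i) j * \<alpha> j"
      using \<omega>[of "\<kappa> i" j] by auto
    moreover have "((\<lambda>z. (\<omega> (\<kappa> i) j *\<^sub>R a j) \<bullet> z) \<longlongrightarrow> (\<omega> (\<kappa> i) j *\<^sub>R a j) \<bullet> cbar) (nhds cbar)"
      by (intro tendsto_intros filterlim_ident)
    ultimately show ?thesis by (auto dest: order_tendstoD)
  qed simp
  ultimately have "\<forall>\<^sub>F z in nhds cbar. (\<forall>k. cbar \<notin> piece a \<alpha> \<omega> k \<longrightarrow> z \<notin> piece a \<alpha> \<omega> k) \<and>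
      (\<forall>i j. a j \<bullet> cbar \<noteq> \<alpha> j \<longrightarrow> (\<omega> (\<kappa> i) j *\<^sub>R a j) \<bullet> z < \<omega> (\<kappa> i) j * \<alpha> j)"
    by (intro eventually_conj eventually_all_finite)
  then obtain \<eta> where "\<eta> > 0"
    and \<eta>1: "\<And>z k. z \<in> ball cbar \<eta> \<Longrightarrow> z \<in> piece a \<alpha> \<omega> k \<Longrightarrow> k \<in> range \<kappa>"
    and \<eta>2: "\<And>z i j. z \<in> ball cbar \<eta> \<Longrightarrow> j \<notin> range \<sigma> \<Longrightarrow> (\<omega> (\<kappa> i) j *\<^sub>R a j) \<bullet> z < \<omega> (\<kappa> i) j * \<alpha> j"
    unfolding eventually_nhds_metric active[symmetric] \<sigma>[symmetric] mem_ball dist_commute[of cbar]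
    by blast
  have comp: "(transpose (A ** P i) *v v) $ p = (\<omega> (\<kappa> i) (\<sigma> p) *\<^sub>R a (\<sigma> p)) \<bullet> v" for i p v
    by (simp only: transpose_mult_component AP_columns)
  have comp': "(transpose (A ** P i) *v (z - cbar)) $ p \<le> 0
      \<longleftrightarrow> (\<omega> (\<kappa> i) (\<sigma> p) *\<^sub>R a (\<sigma> p)) \<bullet> z \<le> \<omega> (\<kappa> i) (\<sigma> p) * \<alpha> (\<sigma> p)" for i p z
    using \<sigma>[of "\<sigma> p"] by (simp add: comp inner_diff_right right_diff_distrib)
  have piece: "z \<in> piece a \<alpha> \<omega> (\<kappa> i) \<longleftrightarrow> (\<forall>p. (transpose (A ** P i) *v (z - cbar)) $ p \<le> 0)"
    if "z \<in> ball cbar \<eta>" for z i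
    unfolding comp' piece_def mem_Collect_eq using \<eta>2[OF that, of _ i] by (metis less_imp_le rangeE)
  interpret plq_chart h Q b \<beta> \<kappa> A P cbar \<eta>
  proof
    show "convex_fun h" "h z \<noteq> - \<infinity>" "transpose (Q (\<kappa> i)) = Q (\<kappa> i)" for z i
      using plq by (auto simp: plq_representation_def proper_fun_def)
  next
    fix z i assume z: "z \<in> ball cbar \<eta>" and "\<And>p. (transpose (A ** P i) *v (z - cbar)) $ p \<le> 0"
    then have "z \<in> piece a \<alpha> \<omega> (\<kappa> i)" by (simp add: piece)
    then show "h z = ereal (1/2 * (z \<bullet> (Q (\<kappa> i) *v z)) + b (\<kappa> i) \<bullet> z + \<beta> (\<kappa> i))"
      using plq by (simp add: plq_representation_def)
  next
    fix z assume z: "z \<in> ball cbar \<eta>" and "h z < \<infinity>"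
    then have "z \<in> effective_dom h" by (simp add: effective_dom_def)
    then obtain k where "z \<in> piece a \<alpha> \<omega> k" using plq by (auto simp: plq_representation_def)
    then show "\<exists>i. \<forall>p. (transpose (A ** P i) *v (z - cbar)) $ p \<le> 0"
      using \<eta>1[OF z] piece[OF z] by blast
  qed (use P_diagonal P_signs Null_A \<open>\<eta> > 0\<close> in auto)
  define D where "D = (\<Inter>k\<in>active_pieces a \<alpha> \<omega> cbar. piece a \<alpha> \<omega> k)"
  have D: "D = (\<Inter>i. piece a \<alpha> \<omega> (\<kappa> i))"
    using bij_betw_imp_surj_on[OF enum_pieces, symmetric] unfolding D_def by simp
  have MD: "M = rel_interior D" using M by (simp add: D_def)
  obtain e where "e > 0" and e: "ball cbar e \<inter> affine hull D \<subseteq> D" and "cbar \<in> D"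
    using cbar_M unfolding MD mem_rel_interior_ball by blast
  have D_flat: "transpose A *v w = transpose A *v cbar" if w: "w \<in> D" for w
  proof -
    have "(transpose (A ** P undefined) *v (w - cbar)) $ p = 0" for p
    proof (rule antisym)
      have le: "(transpose (A ** P undefined) *v (u - cbar)) $ p \<le> 0" if "u \<in> D" for u
        using that unfolding comp' D piece_def by blast
      show "(transpose (A ** P undefined) *v (w - cbar)) $ p \<le> 0" by (rule le[OF w])
      \<comment> \<open>A point slightly beyond \<open>cbar\<close>, seen from \<open>w\<close>, is
        still in \<open>D\<close>; the same sign condition there gives the reverse inequality at
        \<open>w\<close>.\<close>
      obtain t where t: "0 < t" "cbar + t *\<^sub>R (cbar - w) \<in> ball cbar e"
      proof -
        have "cbar \<in> ball cbar e" using \<open>e > 0\<close> by simp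
        then obtain d where "d > 0" "\<And>t. \<bar>t\<bar> < d \<Longrightarrow> cbar + t *\<^sub>R (cbar - w) \<in> ball cbar e"
          using ball_contains_short_segment[of cbar cbar e "cbar - w"] by blast
        then show ?thesis by (intro that[of "d / 2"]) auto
      qed
      have "cbar + t *\<^sub>R (cbar - w) = (1 + t) *\<^sub>R cbar + (- t) *\<^sub>R w" by (simp add: algebra_simps)
      also have "\<dots> \<in> affine hull D"
        using \<open>cbar \<in> D\<close> w by (intro mem_affine[OF affine_affine_hull] hull_inc) auto
      finally have "cbar + t *\<^sub>R (cbar - w) \<in> D" using t(2) e by blast
      from le[OF this] have "t * (transpose (A ** P undefined) *v (cbar - w)) $ p \<le> 0"
        by (simp add: matrix_vector_mult_scaleR)
      then show "0 \<le> (transpose (A ** P undefined) *v (w - cbar)) $ p"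
        using t(1) by (simp add: mult_le_0_iff matrix_vector_mult_diff_distrib)
    qed
    then have "P undefined *v (transpose A *v (w - cbar)) = 0" by (simp add: vec_eq_iff transpose_AP)
    then have "transpose A *v (w - cbar) = 0" by (metis P_involution matrix_vector_mult_0_right)
    then show ?thesis by (simp add: matrix_vector_mult_diff_distrib)
  qed
  have flat_D: "z \<in> D" if "z \<in> manifold" for z
  proof -
    have "(transpose (A ** P i) *v (z - cbar)) $ p \<le> 0" for i p
      using manifold_constraints[OF that, of i 0] by simp
    then show ?thesis using that piece by (simp add: D manifold_def)
  qed
  have "affine {w. transpose A *v w = transpose A *v cbar}"
    unfolding affine_def
    by (auto simp: matrix_vector_right_distrib matrix_vector_mult_scaleR simp flip: scaleR_add_left)
  then have hull: "affine hull D \<subseteq> {w. transpose A *v w = transpose A *v cbar}"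
    using D_flat by (intro hull_minimal) auto
  show ?thesis
  proof (rule that)
    show "plq_chart h Q b \<beta> \<kappa> A P cbar \<eta>" by (rule plq_chart_axioms)
    show "transpose A *v z = transpose A *v cbar" if "z \<in> M" for z
      using that rel_interior_subset D_flat unfolding MD by blast
    show "manifold \<subseteq> M"
    proof
      fix z assume z: "z \<in> manifold"
      then have "z \<in> ball cbar \<eta>" by (simp add: manifold_def)
      then obtain e' where e': "e' > 0" "ball z e' \<subseteq> ball cbar \<eta>"
        using open_contains_ball open_ball by meson
      \<comment> \<open>The affine hull of \<open>D\<close> lies in the flat, so its points close to
        \<open>z\<close> belong to \<open>manifold\<close> and hence to \<open>D\<close>.\<close>
      have "ball z e' \<inter> affine hull D \<subseteq> D"
        using e'(2) hull flat_D unfolding manifold_def by blast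
      then show "z \<in> M" using e'(1) flat_D[OF z] unfolding MD mem_rel_interior_ball by blast
    qed
  qed
qed

section \<open>Newton's method for the KKT system\<close>

lemma has_derivative_vec_lambda:
  fixes f :: "'i::finite \<Rightarrow> 'a::real_normed_vector \<Rightarrow> real"
  assumes "\<And>i. (f i has_derivative F i) (at x)"
  shows "((\<lambda>z. \<chi> i. f i z) has_derivative (\<lambda>v. \<chi> i. F i v)) (at x)"
proof -
  have eq: "(\<chi> i. g i) = (\<Sum>i\<in>UNIV. g i *\<^sub>R axis i (1::real))" for g :: "'i \<Rightarrow> real"
    using basis_expansion[of "\<chi> i. g i"] by (simp add: scalar_mult_eq_scaleR)
  show ?thesis unfolding eq by (intro has_derivative_sum has_derivative_scaleR_left assms)
qed

lemma inner_mult_axis: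
  fixes B :: "real^'n^'m"
  shows "y \<bullet> (B *v axis i 1) = (transpose B *v y) $ i"
  using inner_matrix_transpose[of B "axis i 1" y] inner_commute[of y "B *v axis i 1"]
  by (simp add: inner_axis')

lemma has_derivative_tendsto_nhds:
  "(f has_derivative F) (at x) \<Longrightarrow> (f \<longlongrightarrow> f x) (nhds x)"
  using has_derivative_continuous isCont_def tendsto_at_iff_tendsto_nhds by blast

section \<open>Derivatives of a map with \<open>C_smooth 3\<close>\<close>

locale C3_map =
  fixes c :: "real^'n \<Rightarrow> real^'m"
  assumes smooth: "C_smooth 3 c"
begin

abbreviation J :: "real^'n \<Rightarrow> real^'n^'m" where "J x \<equiv> jacobian c (at x)"

text \<open>The base point comes last, so that \<open>D2 v w\<close> is a function of the point and
  matches the recursion of \<open>C_smooth\<close> along fixed vectors.\<close>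

definition D2 :: "real^'n \<Rightarrow> real^'n \<Rightarrow> real^'n \<Rightarrow> real^'m" where
  "D2 v w x = frechet_derivative (\<lambda>z. J z *v v) (at x) w"

lemma c_has_derivative: "(c has_derivative (\<lambda>v. J x *v v)) (at x)"
  using smooth by (simp add: eval_nat_numeral flip: jacobian_works)

lemma J_mult_smooth: "C_smooth 2 (\<lambda>x. J x *v v)"
proof -
  have "(\<lambda>x. frechet_derivative c (at x) v) = (\<lambda>x. J x *v v)"
    by (simp flip: frechet_derivative_at[OF c_has_derivative])
  moreover have "C_smooth 2 (\<lambda>x. frechet_derivative c (at x) v)"
    using smooth by (simp add: eval_nat_numeral)
  ultimately show ?thesis by simp
qed

lemma D2_has_derivative: "((\<lambda>z. J z *v v) has_derivative (\<lambda>w. D2 v w x)) (at x)"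
  using J_mult_smooth[of v] by (simp add: eval_nat_numeral D2_def frechet_derivative_works)

lemma D2_smooth: "C_smooth 1 (D2 v w)"
  using J_mult_smooth[of v] by (simp add: eval_nat_numeral D2_def[abs_def])

lemma D2_differentiable: "D2 v w differentiable at x"
  using D2_smooth[of v w] by simp

lemma J_mult_tendsto: "((\<lambda>z. J z *v v) \<longlongrightarrow> J x *v v) (nhds x)"
  by (rule has_derivative_tendsto_nhds[OF D2_has_derivative])

lemma J_tendsto: "(J \<longlongrightarrow> J x) (nhds x)"
proof (intro vec_tendstoI)
  fix i j
  have "((\<lambda>z. (J z *v axis j 1) $ i) \<longlongrightarrow> (J x *v axis j 1) $ i) (nhds x)"
    by (intro tendsto_vec_nth J_mult_tendsto)
  then show "((\<lambda>z. J z $ i $ j) \<longlongrightarrow> J x $ i $ j) (nhds x)"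
    by (simp add: matrix_vector_mul_component inner_axis)
qed

lemma D2_tendsto: "(D2 v w \<longlongrightarrow> D2 v w x) (nhds x)"
  using D2_differentiable has_derivative_tendsto_nhds unfolding differentiable_def by blast

lemma D2_symmetric: "y \<bullet> D2 v w x = y \<bullet> D2 w v x"
proof -
  have "((\<lambda>z. y \<bullet> (J z *v v)) has_derivative (\<lambda>w. y \<bullet> D2 v w x)) (at x)" for v
    by (intro has_derivative_inner_right D2_has_derivative)
  moreover have "((\<lambda>z. y \<bullet> c z) has_derivative (\<lambda>v. y \<bullet> (J z *v v))) (at z)" for z
    by (intro has_derivative_inner_right c_has_derivative)
  ultimately show ?thesis
    using second_derivative_symmetric[where f = "\<lambda>z. y \<bullet> c z" and G = "\<lambda>z v. y \<bullet> (J z *v v)"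
        and Fv = "\<lambda>w. y \<bullet> D2 v w x" and Fw = "\<lambda>v. y \<bullet> D2 w v x"] by blast
qed

lemma gradient_inner: "gradient (\<lambda>z. y \<bullet> c z) x = transpose (J x) *v y"
proof -
  have "((\<lambda>z. y \<bullet> c z) has_derivative (\<lambda>v. y \<bullet> (J x *v v))) (at x)"
    by (intro has_derivative_inner_right c_has_derivative)
  then have D: "frechet_derivative (\<lambda>z. y \<bullet> c z) (at x) = (\<lambda>v. y \<bullet> (J x *v v))"
    by (metis frechet_derivative_at)
  then show ?thesis by (simp add: gradient_def vec_eq_iff inner_mult_axis)
qed

lemma transpose_J_has_derivative:
  "((\<lambda>z. transpose (J z) *v y) has_derivative (\<lambda>w. \<chi> i. y \<bullet> D2 (axis i 1) w x)) (at x)"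
proof -
  have "transpose (J z) *v y = (\<chi> i. y \<bullet> (J z *v axis i 1))" for z
    by (simp add: vec_eq_iff inner_mult_axis)
  then show ?thesis
    by (simp only:) (intro has_derivative_vec_lambda has_derivative_inner_right D2_has_derivative)
qed

text \<open>The gradient of \<open>\<lambda>z. y \<bullet> c z\<close> is
  \<open>transpose (J z) *v y\<close>, and uniqueness of derivatives identifies its
  Jacobian.\<close>

lemma hessian_mult: "lagrangian_hessian c y x *v w = (\<chi> i. y \<bullet> D2 (axis i 1) w x)"
proof -
  have "lagrangian_hessian c y x = jacobian (\<lambda>z. transpose (J z) *v y) (at x)"
    by (simp add: lagrangian_hessian_def hessian_def gradient_inner[abs_def])
  moreover have "((\<lambda>z. transpose (J z) *v y) has_derivative
      (\<lambda>w. jacobian (\<lambda>z. transpose (J z) *v y) (at x) *v w)) (at x)"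
    using transpose_J_has_derivative[of y x] jacobian_works differentiable_def by blast
  ultimately show ?thesis
    using has_derivative_unique[OF _ transpose_J_has_derivative] by metis
qed

lemma transpose_J_derivative:
  "((\<lambda>z. transpose (J z) *v y) has_derivative (\<lambda>w. lagrangian_hessian c y x *v w)) (at x)"
  using transpose_J_has_derivative[of y x] by (simp add: hessian_mult)

lemma hessian_component: "lagrangian_hessian c y x $ i $ j = y \<bullet> D2 (axis i 1) (axis j 1) x"
proof -
  have "lagrangian_hessian c y x $ i $ j = (lagrangian_hessian c y x *v axis j 1) $ i"
    by (simp add: matrix_vector_mul_component inner_axis)
  then show ?thesis by (simp add: hessian_mult)
qed

lemma hessian_symmetric: "transpose (lagrangian_hessian c y x) = lagrangian_hessian c y x"
  by (simp add: vec_eq_iff transpose_def hessian_component, intro allI, rule D2_symmetric)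

lemma hessian_linear: "linear (\<lambda>y. lagrangian_hessian c y x)"
  by (rule linearI) (simp_all add: vec_eq_iff hessian_component inner_add_left)

lemma hessian_tendsto:
  assumes "(f \<longlongrightarrow> y) F" "(g \<longlongrightarrow> x) F"
  shows "((\<lambda>u. lagrangian_hessian c (f u) (g u)) \<longlongrightarrow> lagrangian_hessian c y x) F"
  by (intro vec_tendstoI) (simp add: hessian_component,
      intro tendsto_inner assms(1) filterlim_compose[OF D2_tendsto assms(2)])

text \<open>The third-order smoothness of \<open>c\<close>: it makes the linearisation error of
  \<open>transpose (J z) *v y\<close> quadratic instead of merely of smaller than first
  order.\<close>

lemma hessian_mult_differentiable: "(\<lambda>z. lagrangian_hessian c y z *v w) differentiable at x"
proof -
  have "((\<lambda>z. y \<bullet> D2 (axis i 1) w z) has_derivative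
      (\<lambda>v. y \<bullet> frechet_derivative (D2 (axis i 1) w) (at x) v)) (at x)" for i
    using D2_differentiable frechet_derivative_works by (intro has_derivative_inner_right) blast
  then have "((\<lambda>z. \<chi> i. y \<bullet> D2 (axis i 1) w z) has_derivative
      (\<lambda>v. \<chi> i. y \<bullet> frechet_derivative (D2 (axis i 1) w) (at x) v)) (at x)"
    by (rule has_derivative_vec_lambda)
  then show ?thesis unfolding hessian_mult differentiable_def by blast
qed

lemma linearized_tendsto:
  assumes "(f \<longlongrightarrow> x) F" "(g \<longlongrightarrow> x') F"
  shows "((\<lambda>u. linearized c (f u) (g u)) \<longlongrightarrow> linearized c x x') F"
proof -
  have "(c \<longlongrightarrow> c x) (nhds x)"
    by (rule has_derivative_tendsto_nhds[OF c_has_derivative])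
  then show ?thesis unfolding linearized_def
    by (intro tendsto_add tendsto_matrix_vector_mult tendsto_diff assms
        filterlim_compose[OF _ assms(1)] J_tendsto)
qed

end

section \<open>The linearised KKT system\<close>

lemma norm_matrix_vector_le:
  fixes B :: "real^'n^'m"
  shows "norm (B *v v) \<le> norm B * norm v"
proof -
  have "norm (B *v v) \<le> L2_set (\<lambda>i. norm (B $ i) * norm v) UNIV"
    by (subst norm_vec_def, intro L2_set_mono)
      (auto simp: matrix_vector_mul_component Cauchy_Schwarz_ineq2)
  also have "\<dots> = norm B * norm v"
    by (simp add: norm_vec_def[of B] L2_set_left_distrib)
  finally show ?thesis .
qed

text \<open>
  Once the linearised point is forced onto the active manifold, the subproblem is Newton's method
  for the smooth KKT system in \<open>(x, y, \<lambda>)\<close>, where \<open>\<lambda>\<close> enters linearly, so the step does not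
  depend on the previous \<open>\<lambda>\<close>. In the system below \<open>d\<close> stands for \<open>x' - x\<close>.
\<close>

definition newton_operator ::
  "(real^'n \<Rightarrow> real^'m) \<Rightarrow> real^'m^'m \<Rightarrow> real^'l^'m \<Rightarrow> (real^'n) \<times> (real^'m) \<Rightarrow>
   (real^'n) \<times> (real^'m) \<times> (real^'l) \<Rightarrow> (real^'n) \<times> (real^'m) \<times> (real^'l)" where
  "newton_operator c Q A = (\<lambda>(x, y) (d, w, l).
     (lagrangian_hessian c y x *v d + transpose (jacobian c (at x)) *v w,
      w - Q *v (jacobian c (at x) *v d) - A *v l,
      transpose A *v (jacobian c (at x) *v d)))"

definition newton_equations ::
  "(real^'n \<Rightarrow> real^'m) \<Rightarrow> real^'m^'m \<Rightarrow> real^'m \<Rightarrow> real^'l^'m \<Rightarrow> real^'m \<Rightarrow>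
   real^'n \<Rightarrow> real^'m \<Rightarrow> real^'n \<Rightarrow> real^'m \<Rightarrow> real^'l \<Rightarrow> bool" where
  "newton_equations c Q q A cbar x y x' y' l \<longleftrightarrow>
     lagrangian_hessian c y x *v (x' - x) + transpose (jacobian c (at x)) *v y' = 0 \<and>
     y' = Q *v linearized c x x' + q + A *v l \<and>
     transpose A *v linearized c x x' = transpose A *v cbar"

text \<open>Only \<open>x\<close> enters through its increment; \<open>y'\<close> and
  \<open>l\<close> are unknowns themselves. The right-hand side thus depends on \<open>x\<close>
  alone, and the operator maps a space to itself.\<close>

lemma newton_equations_iff:
  "newton_equations c Q q A cbar x y x' y' l \<longleftrightarrow>
     newton_operator c Q A (x, y) (x' - x, y', l)
       = (0, Q *v c x + q, transpose A *v (cbar - c x))"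
  by (auto simp: newton_equations_def newton_operator_def linearized_def algebra_simps
      matrix_vector_right_distrib)

context C3_map
begin

lemma newton_operator_linear: "linear (newton_operator c Q A p)"
  by (cases p, rule linearI)
    (auto simp: newton_operator_def matrix_vector_right_distrib matrix_vector_mult_scaleR algebra_simps)

lemma newton_operator_tendsto:
  "((\<lambda>p. newton_operator c Q A p u) \<longlongrightarrow> newton_operator c Q A p0 u) (nhds p0)"
proof -
  obtain d w l where u: "u = (d, w, l)" by (cases u) auto
  have f: "(fst \<longlongrightarrow> fst p0) (nhds p0)" and s: "(snd \<longlongrightarrow> snd p0) (nhds p0)"
    by (intro tendsto_fst tendsto_snd filterlim_ident)+
  show ?thesis
    unfolding newton_operator_def u case_prod_beta fst_conv snd_conv
    by (intro tendsto_Pair tendsto_add tendsto_diff tendsto_matrix_vector_mult tendsto_transpose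
        tendsto_const hessian_tendsto f s filterlim_compose[OF J_tendsto f])
qed

text \<open>Eliminate \<open>w\<close> and pair the first row with \<open>d\<close>: the term with
  \<open>l\<close> disappears because \<open>transpose A *v (J x *v d) = 0\<close>, so positivity
  gives \<open>d = 0\<close>, and the first row then reduces to
  \<open>(transpose (J x) ** A) *v l = 0\<close>.\<close>

lemma newton_operator_injective:
  fixes A :: "real^'l^'m"
  assumes pos: "\<And>d. (transpose A ** J x) *v d = 0 \<Longrightarrow> d \<noteq> 0 \<Longrightarrow>
      d \<bullet> ((transpose (J x) ** Q ** J x + lagrangian_hessian c y x) *v d) > 0"
    and inj: "\<And>l. (transpose (J x) ** A) *v l = 0 \<Longrightarrow> l = 0"
    and zero: "newton_operator c Q A (x, y) u = 0"
  shows "u = 0"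
proof -
  obtain d w l where u: "u = (d, w, l)" by (cases u) auto
  have 1: "lagrangian_hessian c y x *v d + transpose (J x) *v w = 0"
    and 2: "w = Q *v (J x *v d) + A *v l"
    and 3: "transpose A *v (J x *v d) = 0"
    using zero by (auto simp: u newton_operator_def zero_prod_def algebra_simps)
  have eq: "(transpose (J x) ** Q ** J x + lagrangian_hessian c y x) *v d
      + transpose (J x) *v (A *v l) = 0"
    using 1 unfolding 2
    by (simp add: matrix_vector_right_distrib matrix_vector_mult_add_rdistrib algebra_simps
        flip: matrix_vector_mul_assoc)
  have "d \<bullet> (transpose (J x) *v (A *v l)) = 0"
    using 3 inner_matrix_transpose[of A l "J x *v d"]
    by (simp add: inner_matrix_transpose[symmetric] inner_commute)
  then have "d \<bullet> ((transpose (J x) ** Q ** J x + lagrangian_hessian c y x) *v d) = 0"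
    using arg_cong[OF eq, of "\<lambda>v. d \<bullet> v"] by (simp add: inner_add_right)
  then have d: "d = 0" using pos[of d] 3 by (auto simp: matrix_vector_mul_assoc)
  with eq have "l = 0" by (intro inj) (simp add: matrix_vector_mul_assoc)
  with d 2 show ?thesis by (simp add: u zero_prod_def)
qed

text \<open>With \<open>e x\<close> the linearisation error of \<open>c\<close>, the last two rows
  of the residual are \<open>Q *v e x\<close> and \<open>- (transpose A *v e x)\<close>. The first
  row is the linearisation error of \<open>transpose (J x) *v ybar\<close> plus the Hessian of
  \<open>y - ybar\<close> applied to \<open>xbar - x\<close>, a product of two first-order
  errors.\<close>

lemma newton_residual_quadratic:
  assumes J_ybar: "transpose (J xbar) *v ybar = 0" and ybar: "ybar = Q *v c xbar + q + A *v lbar"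
  shows "\<exists>C. \<forall>\<^sub>F (x, y) in nhds (xbar, ybar).
    norm (newton_operator c Q A (x, y) (xbar - x, ybar, lbar)
      - (0, Q *v c x + q, transpose A *v (c xbar - c x)))
    \<le> C * (norm ((x, y) - (xbar, ybar)))\<^sup>2"
proof -
  define e where "e x = c xbar - c x - J x *v (xbar - x)" for x
  obtain C1 where C1: "\<forall>\<^sub>F x in nhds xbar. norm (e x) \<le> C1 * (norm (x - xbar))\<^sup>2"
    using linearization_error_quadratic[OF c_has_derivative, of xbar] D2_has_derivative
    unfolding e_def differentiable_def by blast
  obtain C2 where C2: "\<forall>\<^sub>F x in nhds xbar.
      norm (transpose (J x) *v ybar + lagrangian_hessian c ybar x *v (xbar - x)) \<le> C2 * (norm (x - xbar))\<^sup>2"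
  proof -
    have "norm (transpose (J xbar) *v ybar - transpose (J x) *v ybar - lagrangian_hessian c ybar x *v (xbar - x))
        = norm (transpose (J x) *v ybar + lagrangian_hessian c ybar x *v (xbar - x))" for x
      unfolding J_ybar
      using norm_minus_cancel[of "transpose (J x) *v ybar + lagrangian_hessian c ybar x *v (xbar - x)"]
      by simp
    then show ?thesis
      using linearization_error_quadratic[OF transpose_J_derivative[of ybar]
          hessian_mult_differentiable[of ybar], of xbar] that
      by auto
  qed
  \<comment> \<open>The Hessian is linear in its multiplier, so one bound near \<open>xbar\<close>
    serves every \<open>w\<close>; it is applied to \<open>w = y - ybar\<close>.\<close>
  obtain C3 where C3: "\<forall>\<^sub>F x in nhds xbar. \<forall>w. norm (lagrangian_hessian c w x) \<le> C3 * norm w"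
  proof -
    have "\<forall>\<^sub>F x in nhds xbar. \<forall>w.
        norm (lagrangian_hessian c w x - lagrangian_hessian c w xbar) \<le> 1 * norm w"
      by (rule linear_family_perturbation[where T = "\<lambda>x w. lagrangian_hessian c w x"])
        (auto intro: hessian_linear hessian_tendsto filterlim_ident)
    moreover obtain K where K: "\<And>w. norm (lagrangian_hessian c w xbar) \<le> norm w * K"
      using bounded_linear.bounded[OF linear_conv_bounded_linear[THEN iffD1, OF hessian_linear]] by blast
    ultimately have "\<forall>\<^sub>F x in nhds xbar. \<forall>w. norm (lagrangian_hessian c w x) \<le> (1 + K) * norm w"
    proof (elim eventually_mono, intro allI)
      fix x w assume "\<forall>w. norm (lagrangian_hessian c w x - lagrangian_hessian c w xbar) \<le> 1 * norm w"
      then have "norm (lagrangian_hessian c w x - lagrangian_hessian c w xbar) \<le> norm w" by simp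
      then show "norm (lagrangian_hessian c w x) \<le> (1 + K) * norm w"
        using K[of w] norm_triangle_sub[of "lagrangian_hessian c w x" "lagrangian_hessian c w xbar"]
        by (simp add: algebra_simps)
    qed
    then show ?thesis by (rule that)
  qed
  have fst_ev: "\<forall>\<^sub>F p in nhds (xbar, ybar). R (fst p)" if "\<forall>\<^sub>F x in nhds xbar. R x" for R
    by (rule eventually_compose_filterlim[OF that])
      (use tendsto_fst[OF filterlim_ident[of "nhds (xbar, ybar)"]] in simp)
  have ev: "\<forall>\<^sub>F (x, y) in nhds (xbar, ybar). norm (e x) \<le> C1 * (norm (x - xbar))\<^sup>2 \<and>
      norm (transpose (J x) *v ybar + lagrangian_hessian c ybar x *v (xbar - x)) \<le> C2 * (norm (x - xbar))\<^sup>2 \<and>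
      (\<forall>w. norm (lagrangian_hessian c w x) \<le> C3 * norm w)"
    using fst_ev[OF C1] fst_ev[OF C2] fst_ev[OF C3] by eventually_elim (simp add: case_prod_beta)
  define C where "C = \<bar>C2\<bar> + \<bar>C3\<bar> + norm Q * \<bar>C1\<bar> + norm (transpose A) * \<bar>C1\<bar>"
  have "norm (newton_operator c Q A (x, y) (xbar - x, ybar, lbar)
      - (0, Q *v c x + q, transpose A *v (c xbar - c x)))
    \<le> C * (norm ((x, y) - (xbar, ybar)))\<^sup>2"
    if 1: "norm (e x) \<le> C1 * (norm (x - xbar))\<^sup>2"
      and 2: "norm (transpose (J x) *v ybar + lagrangian_hessian c ybar x *v (xbar - x)) \<le> C2 * (norm (x - xbar))\<^sup>2"
      and 3: "\<And>w. norm (lagrangian_hessian c w x) \<le> C3 * norm w" for x y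
  proof -
    define s where "s = norm ((x, y) - (xbar, ybar))"
    have sx: "norm (x - xbar) \<le> s" and sy: "norm (y - ybar) \<le> s"
      unfolding s_def using norm_fst_le[of "(x, y) - (xbar, ybar)"] norm_snd_le[of _ "(x, y) - (xbar, ybar)"]
      by (simp_all add: norm_fst_le norm_snd_le)
    have sx2: "(norm (x - xbar))\<^sup>2 \<le> s\<^sup>2" using sx by (intro power_mono) auto
    have scale: "k * (norm (x - xbar))\<^sup>2 \<le> \<bar>k\<bar> * s\<^sup>2" for k
      using sx2 by (intro mult_mono) auto
    have e: "norm (e x) \<le> \<bar>C1\<bar> * s\<^sup>2" using 1 scale[of C1] by linarith
    have "lagrangian_hessian c y x *v (xbar - x) + transpose (J x) *v ybar
        = (transpose (J x) *v ybar + lagrangian_hessian c ybar x *v (xbar - x))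
          + lagrangian_hessian c (y - ybar) x *v (xbar - x)"
      by (simp add: linear_diff[OF hessian_linear] matrix_vector_mult_diff_rdistrib)
    moreover have "norm (lagrangian_hessian c (y - ybar) x *v (xbar - x)) \<le> \<bar>C3\<bar> * s\<^sup>2"
    proof -
      have "norm (lagrangian_hessian c (y - ybar) x *v (xbar - x))
          \<le> norm (lagrangian_hessian c (y - ybar) x) * norm (xbar - x)" by (rule norm_matrix_vector_le)
      also have "\<dots> \<le> (\<bar>C3\<bar> * s) * s"
      proof (rule mult_mono)
        have "C3 * norm (y - ybar) \<le> \<bar>C3\<bar> * s" using sy by (intro mult_mono) auto
        then show "norm (lagrangian_hessian c (y - ybar) x) \<le> \<bar>C3\<bar> * s"
          using 3[of "y - ybar"] by linarith
        show "norm (xbar - x) \<le> s" using sx by (simp add: norm_minus_commute)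
      qed (auto simp: s_def)
      finally show ?thesis by (simp add: power2_eq_square mult.assoc)
    qed
    ultimately have r1: "norm (lagrangian_hessian c y x *v (xbar - x) + transpose (J x) *v ybar)
        \<le> \<bar>C2\<bar> * s\<^sup>2 + \<bar>C3\<bar> * s\<^sup>2"
      using order_trans[OF 2 scale] by (simp only: norm_triangle_mono)
    have r2: "norm (Q *v e x) \<le> norm Q * (\<bar>C1\<bar> * s\<^sup>2)"
      using norm_matrix_vector_le[of Q "e x"] mult_left_mono[OF e, of "norm Q"] by simp
    have r3: "norm (- (transpose A *v e x)) \<le> norm (transpose A) * (\<bar>C1\<bar> * s\<^sup>2)"
      using norm_matrix_vector_le[of "transpose A" "e x"] mult_left_mono[OF e, of "norm (transpose A)"] by simp
    have "newton_operator c Q A (x, y) (xbar - x, ybar, lbar)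
        - (0, Q *v c x + q, transpose A *v (c xbar - c x))
        = (lagrangian_hessian c y x *v (xbar - x) + transpose (J x) *v ybar, Q *v e x, - (transpose A *v e x))"
      by (simp add: newton_operator_def e_def matrix_vector_mult_diff_distrib) (simp add: ybar)
    then have "norm (newton_operator c Q A (x, y) (xbar - x, ybar, lbar)
        - (0, Q *v c x + q, transpose A *v (c xbar - c x)))
      \<le> (\<bar>C2\<bar> * s\<^sup>2 + \<bar>C3\<bar> * s\<^sup>2) + (norm Q * (\<bar>C1\<bar> * s\<^sup>2) + norm (transpose A) * (\<bar>C1\<bar> * s\<^sup>2))"
      using r1 r2 r3 by (simp only:) (intro order_trans[OF norm_Pair_le] add_mono; assumption)
    then show ?thesis unfolding C_def s_def[symmetric] by (simp add: algebra_simps)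
  qed
  then have "\<forall>\<^sub>F (x, y) in nhds (xbar, ybar).
    norm (newton_operator c Q A (x, y) (xbar - x, ybar, lbar)
      - (0, Q *v c x + q, transpose A *v (c xbar - c x)))
    \<le> C * (norm ((x, y) - (xbar, ybar)))\<^sup>2"
    using ev by (elim eventually_mono) blast
  then show ?thesis by blast
qed

text \<open>The operator applied to exact solution minus Newton solution is the residual, so the
  lower bound \<open>\<gamma>\<close> converts the quadratic residual into a quadratic error with
  constant \<open>C / \<gamma>\<close>. Solvability is free: an injective linear endomorphism is
  surjective.\<close>

lemma newton_step:
  fixes A :: "real^'l^'m"
  assumes J_ybar: "transpose (J xbar) *v ybar = 0" and ybar: "ybar = Q *v c xbar + q + A *v lbar"
    and pos: "\<And>d. (transpose A ** J xbar) *v d = 0 \<Longrightarrow> d \<noteq> 0 \<Longrightarrow>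
      d \<bullet> ((transpose (J xbar) ** Q ** J xbar + lagrangian_hessian c ybar xbar) *v d) > 0"
    and inj: "\<And>l. (transpose (J xbar) ** A) *v l = 0 \<Longrightarrow> l = 0"
  shows "\<exists>C. \<forall>\<^sub>F (x, y) in nhds (xbar, ybar). \<exists>x' y' l.
    newton_equations c Q q A (c xbar) x y x' y' l \<and>
    norm ((x', y') - (xbar, ybar)) \<le> C * (norm ((x, y) - (xbar, ybar)))\<^sup>2 \<and>
    (\<forall>x'' y'' l''. newton_equations c Q q A (c xbar) x y x'' y'' l'' \<longrightarrow> x'' = x' \<and> y'' = y')"
proof -
  let ?T = "newton_operator c Q A"
  have inj0: "u = 0" if "?T (xbar, ybar) u = 0" for u
    using pos inj that by (rule newton_operator_injective)
  obtain \<gamma> where "\<gamma> > 0" and \<gamma>: "\<forall>\<^sub>F p in nhds (xbar, ybar). \<forall>u. \<gamma> * norm u \<le> norm (?T p u)"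
    using eventually_uniformly_injective[OF newton_operator_linear newton_operator_tendsto inj0] by blast
  obtain C where C: "\<forall>\<^sub>F (x, y) in nhds (xbar, ybar).
    norm (?T (x, y) (xbar - x, ybar, lbar) - (0, Q *v c x + q, transpose A *v (c xbar - c x)))
    \<le> C * (norm ((x, y) - (xbar, ybar)))\<^sup>2"
    using newton_residual_quadratic[OF J_ybar ybar] by blast
  from \<gamma> C have "\<forall>\<^sub>F (x, y) in nhds (xbar, ybar). \<exists>x' y' l.
    newton_equations c Q q A (c xbar) x y x' y' l \<and>
    norm ((x', y') - (xbar, ybar)) \<le> C / \<gamma> * (norm ((x, y) - (xbar, ybar)))\<^sup>2 \<and>
    (\<forall>x'' y'' l''. newton_equations c Q q A (c xbar) x y x'' y'' l'' \<longrightarrow> x'' = x' \<and> y'' = y')"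
  proof (eventually_elim, clarify)
    fix x y
    assume bound: "\<forall>u. \<gamma> * norm u \<le> norm (?T (x, y) u)"
      and res: "norm (?T (x, y) (xbar - x, ybar, lbar) - (0, Q *v c x + q, transpose A *v (c xbar - c x)))
        \<le> C * (norm ((x, y) - (xbar, ybar)))\<^sup>2"
    have "u = 0" if "?T (x, y) u = 0" for u
      using bound[rule_format, of u] that \<open>\<gamma> > 0\<close> by (simp add: mult_le_0_iff)
    then have T_inj: "inj (?T (x, y))"
      using linear_injective_0[OF newton_operator_linear] by blast
    obtain d y' l where T: "?T (x, y) (d, y', l) = (0, Q *v c x + q, transpose A *v (c xbar - c x))"
      using linear_injective_imp_surjective[OF newton_operator_linear T_inj] by (metis prod_cases3 surjD)
    define x' where "x' = x + d"
    have "newton_equations c Q q A (c xbar) x y x' y' l" by (simp add: newton_equations_iff x'_def T)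
    moreover have "x'' = x' \<and> y'' = y'" if "newton_equations c Q q A (c xbar) x y x'' y'' l''" for x'' y'' l''
    proof -
      have "(x'' - x, y'', l'') = (d, y', l)"
        using that T injD[OF T_inj] unfolding newton_equations_iff by metis
      then show ?thesis by (auto simp: x'_def)
    qed
    moreover have "norm ((x', y') - (xbar, ybar)) \<le> C / \<gamma> * (norm ((x, y) - (xbar, ybar)))\<^sup>2"
    proof -
      let ?u = "(xbar - x, ybar, lbar) - (d, y', l)"
      have "norm ((x', y') - (xbar, ybar)) = norm (xbar - x', ybar - y')"
        by (metis diff_Pair norm_minus_commute)
      also have "\<dots> \<le> norm (xbar - x', ybar - y', lbar - l)" by (simp add: norm_Pair)
      also have "\<dots> = norm ?u" by (simp add: x'_def algebra_simps)
      finally have "norm ((x', y') - (xbar, ybar)) \<le> norm ?u" .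
      moreover have "\<gamma> * norm ?u \<le> C * (norm ((x, y) - (xbar, ybar)))\<^sup>2"
        using bound[rule_format, of ?u] res unfolding linear_diff[OF newton_operator_linear] T by linarith
      then have "norm ?u \<le> C / \<gamma> * (norm ((x, y) - (xbar, ybar)))\<^sup>2"
        using \<open>\<gamma> > 0\<close> by (simp add: field_simps)
      ultimately show ?thesis by linarith
    qed
    ultimately show "\<exists>x' y' l. newton_equations c Q q A (c xbar) x y x' y' l \<and>
      norm ((x', y') - (xbar, ybar)) \<le> C / \<gamma> * (norm ((x, y) - (xbar, ybar)))\<^sup>2 \<and>
      (\<forall>x'' y'' l''. newton_equations c Q q A (c xbar) x y x'' y'' l'' \<longrightarrow> x'' = x' \<and> y'' = y')"
      by blast
  qed
  then show ?thesis by blast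
qed

end

section \<open>Local convergence\<close>

text \<open>The quadratic estimate alone does not force convergence from an arbitrary start; halving
  does, geometrically.\<close>

lemma contraction_converges_quadratically:
  fixes u :: "nat \<Rightarrow> 'a::real_normed_vector"
  assumes quad: "\<And>k. norm (u (Suc k) - l) \<le> C * (norm (u k - l))\<^sup>2"
    and half: "\<And>k. norm (u (Suc k) - l) \<le> 1/2 * norm (u k - l)"
  shows "converges_quadratically u l"
proof -
  have bound: "norm (u k - l) \<le> (1/2) ^ k * norm (u 0 - l)" for k
  proof (induction k)
    case (Suc k)
    then show ?case using half[of k] by simp
  qed simp
  have "(\<lambda>k. (1/2) ^ k * norm (u 0 - l)) \<longlonglongrightarrow> 0 * norm (u 0 - l)"
    by (intro tendsto_mult tendsto_const LIMSEQ_power_zero) simp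
  then have "(\<lambda>k. u k - l) \<longlonglongrightarrow> 0"
    by (intro Lim_null_comparison[of "\<lambda>k. u k - l" "\<lambda>k. (1/2) ^ k * norm (u 0 - l)"] always_eventually allI bound)
      simp
  then have "u \<longlonglongrightarrow> l" by (rule LIM_zero_cancel)
  then show ?thesis using quad unfolding converges_quadratically_def by blast
qed

locale composite_problem = plq_chart h Q b \<beta> \<kappa> A P "c xbar" \<eta> + C3_map c
  for h :: "real^'m \<Rightarrow> ereal" and Q b \<beta> and \<kappa> :: "'b::finite \<Rightarrow> 'k" and A :: "real^'l^'m" and P \<eta>
    and c :: "real^'n \<Rightarrow> real^'m" and xbar +
  fixes ybar :: "real^'m" and \<mu>bar :: "real^'l^'b"
  assumes strict_critical: "Null (transpose (J xbar)) \<inter> rel_interior (subdifferential h (c xbar)) = {ybar}"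
    and \<mu>bar_represents: "represents Q b \<kappa> A P (c xbar) ybar \<mu>bar"
    and \<mu>bar_pos: "\<And>i p. \<mu>bar $ i $ p > 0"
    and second_order: "\<And>d. d \<in> Null (transpose A ** J xbar) - {0} \<Longrightarrow>
         second_dir_deriv h (c xbar) (J xbar *v d) + ereal (d \<bullet> (lagrangian_hessian c ybar xbar *v d)) > 0"
begin

lemma cbar_manifold: "c xbar \<in> manifold"
  using \<eta>_pos by (simp add: manifold_def)

lemma J_ybar: "transpose (J xbar) *v ybar = 0"
  using strict_critical by (auto simp: Null_def)

lemma piece_hessian_pos:
  assumes "(transpose A ** J xbar) *v d = 0" "d \<noteq> 0"
  shows "d \<bullet> ((transpose (J xbar) ** Q (\<kappa> i) ** J xbar + lagrangian_hessian c ybar xbar) *v d) > 0"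
proof -
  have "transpose A *v (J xbar *v d) = 0" using assms(1) by (simp add: matrix_vector_mul_assoc)
  from second_dir_deriv_tangential[OF cbar_manifold this, of i] second_order[of d] assms
  have "(J xbar *v d) \<bullet> (Q (\<kappa> i) *v (J xbar *v d)) + d \<bullet> (lagrangian_hessian c ybar xbar *v d) > 0"
    by (simp add: Null_def)
  then show ?thesis
    by (simp add: matrix_vector_mult_add_rdistrib inner_add_right inner_matrix_transpose
        flip: matrix_vector_mul_assoc)
qed

lemma transversal:
  assumes "(transpose (J xbar) ** A) *v l = 0"
  shows "l = 0"
proof -
  obtain t where t: "t > 0" "ybar + t *\<^sub>R (A *v l) \<in> rel_interior (subdifferential h (c xbar))"
    using rel_interior_shift[OF cbar_manifold \<mu>bar_represents \<mu>bar_pos] by blast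
  moreover have "transpose (J xbar) *v (ybar + t *\<^sub>R (A *v l)) = 0"
    using assms by (simp add: matrix_vector_right_distrib matrix_vector_mult_scaleR J_ybar
        matrix_vector_mul_assoc)
  ultimately have "ybar + t *\<^sub>R (A *v l) \<in> Null (transpose (J xbar)) \<inter> rel_interior (subdifferential h (c xbar))"
    by (simp add: Null_def)
  then have "ybar + t *\<^sub>R (A *v l) = ybar" unfolding strict_critical by simp
  then have "A *v l = 0" using t(1) by simp
  then show ?thesis using Null_A by (auto simp: Null_def)
qed

text \<open>The piece met by a perturbed point is not known beforehand, so the constants must serve
  all pieces: there are finitely many, and the least \<open>\<gamma> i\<close> with the sum of all
  \<open>K i\<close> works for each.\<close>

lemma eventually_growth:
  "\<exists>K\<ge>0. \<exists>\<gamma>>0. \<forall>\<^sub>F (x, y) in nhds (xbar, ybar). \<forall>i v. \<gamma> * (norm v)\<^sup>2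
    \<le> v \<bullet> ((transpose (J x) ** Q (\<kappa> i) ** J x + lagrangian_hessian c y x) *v v)
      + K * (norm ((transpose A ** J x) *v v))\<^sup>2"
proof -
  define B where "B i = (\<lambda>(x, y). transpose (J x) ** Q (\<kappa> i) ** J x + lagrangian_hessian c y x)" for i
  define S where "S = (\<lambda>(x, y :: real^'m). transpose A ** J x)"
  let ?p = "(xbar, ybar)"
  have f: "(fst \<longlongrightarrow> xbar) (nhds ?p)" and s: "(snd \<longlongrightarrow> ybar) (nhds ?p)"
    using tendsto_fst[OF filterlim_ident[of "nhds ?p"]] tendsto_snd[OF filterlim_ident[of "nhds ?p"]] by simp_all
  have J_lim: "((\<lambda>p. J (fst p)) \<longlongrightarrow> J xbar) (nhds ?p)" by (rule filterlim_compose[OF J_tendsto f])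
  have B_lim: "(B i \<longlongrightarrow> B i ?p) (nhds ?p)" for i
    unfolding B_def case_prod_beta fst_conv snd_conv
    by (intro tendsto_add tendsto_matrix_matrix_mult tendsto_transpose tendsto_const hessian_tendsto J_lim f s)
  have S_lim: "(S \<longlongrightarrow> S ?p) (nhds ?p)"
    unfolding S_def case_prod_beta fst_conv snd_conv
    by (intro tendsto_matrix_matrix_mult tendsto_const J_lim)
  define G where "G i k g = (\<forall>\<^sub>F p in nhds ?p. \<forall>v.
    g * (norm v)\<^sup>2 \<le> v \<bullet> (B i p *v v) + k * (norm (S p *v v))\<^sup>2)" for i k g
  have "\<exists>k g. k \<ge> 0 \<and> g > 0 \<and> G i k g" for i
    unfolding G_def
    using eventually_quadratic_form_penalty[of S ?p "B i", OF _ B_lim S_lim] piece_hessian_pos[of _ i]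
    by (simp add: B_def S_def)
  then obtain K \<gamma> where K: "\<And>i. K i \<ge> 0" "\<And>i. \<gamma> i > 0" and ev: "\<And>i. G i (K i) (\<gamma> i)"
    by metis
  have "\<forall>\<^sub>F p in nhds ?p. \<forall>i v. Min (range \<gamma>) * (norm v)\<^sup>2
      \<le> v \<bullet> (B i p *v v) + sum K UNIV * (norm (S p *v v))\<^sup>2"
  proof (intro eventually_all_finite, rule eventually_mono[OF ev[unfolded G_def]], intro allI)
    fix i p and v :: "real^'n"
    assume "\<forall>v. \<gamma> i * (norm v)\<^sup>2 \<le> v \<bullet> (B i p *v v) + K i * (norm (S p *v v))\<^sup>2"
    moreover have "Min (range \<gamma>) * (norm v)\<^sup>2 \<le> \<gamma> i * (norm v)\<^sup>2" by (intro mult_right_mono) auto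
    moreover have "K i * (norm (S p *v v))\<^sup>2 \<le> sum K UNIV * (norm (S p *v v))\<^sup>2"
      using K by (intro mult_right_mono member_le_sum) auto
    ultimately show "Min (range \<gamma>) * (norm v)\<^sup>2 \<le> v \<bullet> (B i p *v v) + sum K UNIV * (norm (S p *v v))\<^sup>2"
      by (smt (verit))
  qed
  moreover have "sum K UNIV \<ge> 0" using K by (intro sum_nonneg)
  moreover have "Min (range \<gamma>) > 0" using K by (subst Min_gr_iff) auto
  ultimately show ?thesis unfolding B_def S_def case_prod_unfold fst_conv snd_conv by blast
qed

text \<open>Transversality at \<open>xbar\<close> is injectivity of
  \<open>\<lambda>l. transpose (J xbar) *v (A *v l)\<close>, which is stable under
  perturbation.\<close>

lemma eventually_transversal:
  "\<forall>\<^sub>F (x, y) in nhds (xbar, ybar). Null (transpose (J x)) \<inter> Ran A = {0}"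
proof -
  let ?T = "\<lambda>x l. transpose (J x) *v (A *v l)"
  have "linear (?T x)" for x
    by (rule linearI) (simp_all add: matrix_vector_right_distrib matrix_vector_mult_scaleR)
  moreover have "((\<lambda>x. ?T x l) \<longlongrightarrow> ?T xbar l) (nhds xbar)" for l
    by (intro tendsto_matrix_vector_mult tendsto_transpose J_tendsto tendsto_const)
  moreover have "l = 0" if "?T xbar l = 0" for l
    using transversal that by (simp add: matrix_vector_mul_assoc)
  ultimately have "\<exists>\<gamma>>0. \<forall>\<^sub>F x in nhds xbar. \<forall>l. \<gamma> * norm l \<le> norm (?T x l)"
    by (rule eventually_uniformly_injective)
  then obtain \<gamma> where "\<gamma> > 0" and \<gamma>: "\<forall>\<^sub>F x in nhds xbar. \<forall>l. \<gamma> * norm l \<le> norm (?T x l)" by blast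
  have "Null (transpose (J x)) \<inter> Ran A = {0}"
    if T: "\<forall>l. \<gamma> * norm l \<le> norm (?T x l)" for x
  proof -
    have "A *v l = 0" if "?T x l = 0" for l
    proof -
      have "\<gamma> * norm l \<le> 0" using T[rule_format, of l] that by simp
      then show ?thesis using \<open>\<gamma> > 0\<close> by (simp add: mult_le_0_iff)
    qed
    moreover have "0 \<in> Null (transpose (J x)) \<inter> Ran A"
      unfolding Null_def Ran_def by (auto intro: image_eqI[of _ _ 0])
    ultimately show ?thesis by (auto simp: Null_def Ran_def)
  qed
  then have "\<forall>\<^sub>F x in nhds xbar. Null (transpose (J x)) \<inter> Ran A = {0}"
    by (rule eventually_mono[OF \<gamma>])
  then have "\<forall>\<^sub>F p in nhds (xbar, ybar). Null (transpose (J (fst p))) \<inter> Ran A = {0}"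
    by (rule eventually_compose_filterlim)
      (use tendsto_fst[OF filterlim_ident[of "nhds (xbar, ybar)"]] in simp)
  then show ?thesis by (simp add: case_prod_unfold)
qed

text \<open>The triple is the old point and the new pair; the old \<open>y\<close> enters neither
  quantity. At the reference triple the linearised point is \<open>c xbar\<close> and the multiplier
  is \<open>\<mu>bar\<close>, so continuity suffices.\<close>

lemma eventually_multiplier_close:
  assumes "\<epsilon> > 0"
  shows "\<forall>\<^sub>F (x, x', y') in nhds (xbar, xbar, ybar). linearized c x x' \<in> ball (c xbar) \<eta> \<and>
    dist (multiplier Q b \<kappa> A P (linearized c x x') y') \<mu>bar < \<epsilon>"
proof -
  let ?p = "(xbar, xbar, ybar)"
  have id: "((\<lambda>p. p) \<longlongrightarrow> ?p) (nhds ?p)" by (rule filterlim_ident)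
  have f: "(fst \<longlongrightarrow> xbar) (nhds ?p)" and s: "((\<lambda>p. fst (snd p)) \<longlongrightarrow> xbar) (nhds ?p)"
    and t: "((\<lambda>p. snd (snd p)) \<longlongrightarrow> ybar) (nhds ?p)"
    using tendsto_fst[OF id] tendsto_fst[OF tendsto_snd[OF id]] tendsto_snd[OF tendsto_snd[OF id]] by simp_all
  have "linearized c xbar xbar = c xbar" by (simp add: linearized_def)
  with linearized_tendsto[OF f s]
  have z: "((\<lambda>p. linearized c (fst p) (fst (snd p))) \<longlongrightarrow> c xbar) (nhds ?p)" by simp
  have "\<forall>\<^sub>F p in nhds ?p. linearized c (fst p) (fst (snd p)) \<in> ball (c xbar) \<eta>"
    by (rule topological_tendstoD[OF z]) (use \<eta>_pos in auto)
  moreover have "((\<lambda>p. multiplier Q b \<kappa> A P (linearized c (fst p) (fst (snd p))) (snd (snd p))) \<longlongrightarrow> \<mu>bar) (nhds ?p)"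
    using tendsto_multiplier[OF z t] represents_unique[OF \<mu>bar_represents] by simp
  then have "\<forall>\<^sub>F p in nhds ?p.
      dist (multiplier Q b \<kappa> A P (linearized c (fst p) (fst (snd p))) (snd (snd p))) \<mu>bar < \<epsilon>"
    using \<open>\<epsilon> > 0\<close> by (rule tendstoD)
  ultimately show ?thesis by eventually_elim (simp add: case_prod_unfold)
qed

text \<open>The equations mention one piece \<open>j\<close> only. On the manifold this fixes the
  tangential part of \<open>y'\<close>, hence a representation in all pieces, and positive
  multipliers make \<open>y'\<close> a subgradient.\<close>

lemma newton_equations_optimality:
  assumes "linearized c x x' \<in> ball (c xbar) \<eta>"
    and "\<And>i p. multiplier Q b \<kappa> A P (linearized c x x') y' $ i $ p > 0"
    and eqs: "newton_equations c (Q (\<kappa> j)) (b (\<kappa> j)) A (c xbar) x y x' y' l"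
  shows "linearized c x x' \<in> manifold"
    and "represents Q b \<kappa> A P (linearized c x x') y' (multiplier Q b \<kappa> A P (linearized c x x') y')"
    and "newton_optimality h c Q b \<kappa> A P x y x' y' (multiplier Q b \<kappa> A P (linearized c x x') y')"
proof -
  show z: "linearized c x x' \<in> manifold"
    using assms(1) eqs by (simp add: manifold_def newton_equations_def)
  have "y' \<bullet> v = piece_grad j (linearized c x x') \<bullet> v" if "transpose A *v v = 0" for v
    using eqs that by (simp add: newton_equations_def inner_add_left inner_matrix_transpose)
  from represents_multiplier[OF z this]
  show rep: "represents Q b \<kappa> A P (linearized c x x') y' (multiplier Q b \<kappa> A P (linearized c x x') y')" .
  show "newton_optimality h c Q b \<kappa> A P x y x' y' (multiplier Q b \<kappa> A P (linearized c x x') y')"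
    unfolding newton_optimality_def
    using eqs rep represents_subgradient[OF z rep] assms(2) less_imp_le
    by (auto simp: newton_equations_def)
qed

text \<open>Converse direction once the linearised point is known to be flat; the unknown
  \<open>l\<close> is block \<open>j\<close> of the multiplier with its signs undone by
  \<open>P j\<close>.\<close>

lemma newton_optimality_equations:
  assumes opt: "newton_optimality h c Q b \<kappa> A P x y x' y' \<mu>'"
    and flat: "transpose A *v linearized c x x' = transpose A *v c xbar"
  shows "newton_equations c (Q (\<kappa> j)) (b (\<kappa> j)) A (c xbar) x y x' y' (P j *v \<mu>' $ j)"
  using opt flat unfolding newton_equations_def newton_optimality_def represents_def
  by (auto simp: matrix_vector_mul_assoc)

end

text \<open>No semidefiniteness of the Hessian is assumed, so stationary points of a subproblem
  elsewhere are not excluded. Uniqueness is therefore claimed among sequences that stay in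
  \<open>N\<close> or whose linearised points stay on \<open>M\<close>; either property puts every
  linearised point on the flat, where the step is the solution of a nonsingular linear
  system.\<close>

theorem theorem7p3:
  fixes h :: "real^'m \<Rightarrow> ereal"
    and c :: "real^'n \<Rightarrow> real^'m"
    and Q :: "'k::finite \<Rightarrow> real^'m^'m" and b :: "'k \<Rightarrow> real^'m" and \<beta> :: "'k \<Rightarrow> real"
    and a :: "'j::finite \<Rightarrow> real^'m" and \<alpha> :: "'j \<Rightarrow> real" and \<omega> :: "'k \<Rightarrow> 'j \<Rightarrow> real"
    and \<kappa> :: "'b::finite \<Rightarrow> 'k" and last_b :: 'b
    and \<sigma> :: "'l::finite \<Rightarrow> 'j"
    and A :: "real^'l^'m" and P :: "'b \<Rightarrow> real^'l^'l"
    and M :: "(real^'m) set"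
    and xbar :: "real^'n" and cbar ybar :: "real^'m" and \<mu>bar :: "real^'l^'b"
  assumes plq: "plq_representation h Q b \<beta> a \<alpha> \<omega>"
    and smooth: "C_smooth 3 c"
    and cbar: "cbar = c xbar"
    and xbar_dom: "xbar \<in> effective_dom (h \<circ> c)"
    and enum_pieces: "bij_betw \<kappa> UNIV (active_pieces a \<alpha> \<omega> cbar)"
    and at_least_two: "CARD('b) \<ge> 2"
    and M: "M = rel_interior (\<Inter>k\<in>active_pieces a \<alpha> \<omega> cbar. piece a \<alpha> \<omega> k)"
    and cbar_M: "cbar \<in> M"
    and enum_active: "bij_betw \<sigma> UNIV (active_hyperplanes a \<alpha> cbar)"
    and A_columns: "\<And>p. column p A = \<omega> (\<kappa> last_b) (\<sigma> p) *\<^sub>R a (\<sigma> p)"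
    and P_diagonal: "\<And>i p q. p \<noteq> q \<Longrightarrow> P i $ p $ q = 0"
    and P_signs: "\<And>i p. P i $ p $ p \<in> {1, -1}"
    and AP_columns: "\<And>i p. column p (A ** P i) = \<omega> (\<kappa> i) (\<sigma> p) *\<^sub>R a (\<sigma> p)"
    and nondegenerate: "Null A = {0}"
    and strict_critical:
      "Null (transpose (jacobian c (at xbar))) \<inter> rel_interior (subdifferential h cbar) = {ybar}"
    and \<mu>bar_represents: "represents Q b \<kappa> A P cbar ybar \<mu>bar"
    and \<mu>bar_pos: "\<And>i p. \<mu>bar $ i $ p > 0"
    and second_order:
      "\<And>d. d \<in> Null (transpose A ** jacobian c (at xbar)) - {0} \<Longrightarrow>
         second_dir_deriv h cbar (jacobian c (at xbar) *v d)
           + ereal (d \<bullet> (lagrangian_hessian c ybar xbar *v d)) > 0"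
  shows "\<exists>N :: ((real^'n) \<times> (real^'m) \<times> (real^'l^'b)) set.
    open N \<and> (xbar, ybar, \<mu>bar) \<in> N \<and>
    (\<forall>x y \<mu>. (x, y, \<mu>) \<in> N \<longrightarrow>
       (\<forall>j\<in>active_pieces a \<alpha> \<omega> cbar.
          \<forall>d\<in>Null (transpose A ** jacobian c (at x)) - {0}.
            d \<bullet> ((transpose (jacobian c (at x)) ** Q j ** jacobian c (at x)) *v d)
              + d \<bullet> (lagrangian_hessian c y x *v d) > 0) \<and>
       Null (transpose (jacobian c (at x))) \<inter> Ran A = {0}) \<and>
    (\<forall>x0 y0 \<mu>0. (x0, y0, \<mu>0) \<in> N \<longrightarrow>
       (\<exists>xs ys \<mu>s.
          xs 0 = x0 \<and> ys 0 = y0 \<and> \<mu>s 0 = \<mu>0 \<and>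
          newton_sequence h c Q b \<kappa> A P xs ys \<mu>s \<and>
          (\<forall>k. (xs k, ys k, \<mu>s k) \<in> N) \<and>
          (\<forall>xs' ys' \<mu>s'.
             xs' 0 = x0 \<and> ys' 0 = y0 \<and> \<mu>s' 0 = \<mu>0 \<and>
             newton_sequence h c Q b \<kappa> A P xs' ys' \<mu>s' \<and>
             ((\<forall>k. (xs' k, ys' k, \<mu>s' k) \<in> N) \<or>
              (\<forall>k. linearized c (xs' k) (xs' (Suc k)) \<in> M)) \<longrightarrow>
             xs' = xs \<and> ys' = ys \<and> \<mu>s' = \<mu>s) \<and>
          (\<forall>k. linearized c (xs k) (xs (Suc k)) \<in> M \<and>
               (\<forall>i p. multiplier Q b \<kappa> A P (linearized c (xs k) (xs (Suc k))) (ys (Suc k))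
                        $ i $ p > 0) \<and>
               ys (Suc k) \<in> rel_interior (subdifferential h (linearized c (xs k) (xs (Suc k)))) \<and>
               lagrangian_hessian c (ys k) (xs k) *v (xs (Suc k) - xs k)
                 + transpose (jacobian c (at (xs k))) *v ys (Suc k) = 0 \<and>
               strong_local_minimizer (newton_model h c (xs k) (ys k)) (xs (Suc k) - xs k)) \<and>
          converges_quadratically (\<lambda>k. (xs k, ys k)) (xbar, ybar)))"
proof -
  obtain \<eta> where chart: "plq_chart h Q b \<beta> \<kappa> A P cbar \<eta>"
    and M_flat: "\<And>z. z \<in> M \<Longrightarrow> transpose A *v z = transpose A *v cbar"
    and flat_M: "plq_chart.manifold A cbar \<eta> \<subseteq> M"
    using plq_chart_exists[OF plq enum_pieces M cbar_M enum_active P_diagonal P_signs AP_columns nondegenerate]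
    by blast
  interpret plq_chart h Q b \<beta> \<kappa> A P "c xbar" \<eta> using chart by (simp add: cbar)
  interpret composite_problem h Q b \<beta> \<kappa> A P \<eta> c xbar ybar \<mu>bar
    by unfold_locales
      (use smooth strict_critical \<mu>bar_represents \<mu>bar_pos second_order in \<open>simp_all add: cbar\<close>)
  \<comment> \<open>An arbitrary active piece; the smooth KKT system is written with its quadratic
    data.\<close>
  define i0 :: 'b where "i0 = undefined"
  define pbar where "pbar = (xbar, ybar)"
  let ?mult = "\<lambda>x x' y'. multiplier Q b \<kappa> A P (linearized c x x') y'"
  let ?eqs = "newton_equations c (Q (\<kappa> i0)) (b (\<kappa> i0)) A (c xbar)"

  have "\<forall>\<^sub>F \<mu> in nhds \<mu>bar. \<forall>i p. \<mu> $ i $ p > 0"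
  proof (intro eventually_all_finite)
    fix i p
    have "((\<lambda>\<mu>. \<mu> $ i $ p) \<longlongrightarrow> \<mu>bar $ i $ p) (nhds \<mu>bar)"
      by (intro tendsto_vec_nth filterlim_ident)
    then show "\<forall>\<^sub>F \<mu> in nhds \<mu>bar. \<mu> $ i $ p > 0" by (rule order_tendstoD) (rule \<mu>bar_pos)
  qed
  then obtain \<epsilon> where "\<epsilon> > 0" and \<epsilon>: "\<And>\<mu> i p. dist \<mu> \<mu>bar < \<epsilon> \<Longrightarrow> \<mu> $ i $ p > 0"
    unfolding eventually_nhds_metric by blast

  obtain r where "r > 0" and r: "\<And>x x' y'. dist (x, x', y') (xbar, xbar, ybar) < r \<Longrightarrow>
      linearized c x x' \<in> ball (c xbar) \<eta> \<and> dist (?mult x x' y') \<mu>bar < \<epsilon>"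
    using eventually_multiplier_close[OF \<open>\<epsilon> > 0\<close>] unfolding eventually_nhds_metric by force

  obtain K \<gamma> where K: "K \<ge> 0" "\<gamma> > 0"
    and growth: "\<forall>\<^sub>F (x, y) in nhds pbar. \<forall>i v. \<gamma> * (norm v)\<^sup>2
      \<le> v \<bullet> ((transpose (J x) ** Q (\<kappa> i) ** J x + lagrangian_hessian c y x) *v v)
        + K * (norm ((transpose A ** J x) *v v))\<^sup>2"
    using eventually_growth unfolding pbar_def by blast
  have "ybar = Q (\<kappa> i0) *v c xbar + b (\<kappa> i0) + A *v (P i0 *v \<mu>bar $ i0)"
    using \<mu>bar_represents by (simp add: represents_def matrix_vector_mul_assoc cbar)
  from newton_step[OF J_ybar this piece_hessian_pos transversal]
  obtain C where step: "\<forall>\<^sub>F (x, y) in nhds pbar. \<exists>x' y' l. ?eqs x y x' y' l \<and>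
      norm ((x', y') - pbar) \<le> C * (norm ((x, y) - pbar))\<^sup>2 \<and>
      (\<forall>x'' y'' l''. ?eqs x y x'' y'' l'' \<longrightarrow> x'' = x' \<and> y'' = y')"
    unfolding pbar_def by blast
  obtain \<delta>0 where "\<delta>0 > 0" and near: "\<And>x y. dist (x, y) pbar < \<delta>0 \<Longrightarrow>
      (\<forall>i v. \<gamma> * (norm v)\<^sup>2
        \<le> v \<bullet> ((transpose (J x) ** Q (\<kappa> i) ** J x + lagrangian_hessian c y x) *v v)
          + K * (norm ((transpose A ** J x) *v v))\<^sup>2) \<and>
      (\<exists>x' y' l. ?eqs x y x' y' l \<and> norm ((x', y') - pbar) \<le> C * (norm ((x, y) - pbar))\<^sup>2 \<and>
        (\<forall>x'' y'' l''. ?eqs x y x'' y'' l'' \<longrightarrow> x'' = x' \<and> y'' = y')) \<and>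
      Null (transpose (J x)) \<inter> Ran A = {0}"
  proof -
    have "\<forall>\<^sub>F (x, y) in nhds pbar. (\<forall>i v. \<gamma> * (norm v)\<^sup>2
        \<le> v \<bullet> ((transpose (J x) ** Q (\<kappa> i) ** J x + lagrangian_hessian c y x) *v v)
          + K * (norm ((transpose A ** J x) *v v))\<^sup>2) \<and>
      (\<exists>x' y' l. ?eqs x y x' y' l \<and> norm ((x', y') - pbar) \<le> C * (norm ((x, y) - pbar))\<^sup>2 \<and>
        (\<forall>x'' y'' l''. ?eqs x y x'' y'' l'' \<longrightarrow> x'' = x' \<and> y'' = y')) \<and>
      Null (transpose (J x)) \<inter> Ran A = {0}"
      using growth step eventually_transversal[folded pbar_def]
      unfolding case_prod_unfold by (intro eventually_conj)
    then show ?thesis using that unfolding eventually_nhds_metric by fast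
  qed
  \<comment> \<open>\<open>\<delta>0\<close> secures the uniform estimates, \<open>r / 2\<close>
    keeps old point and new pair together within \<open>r\<close>, and the last bound gives
    \<open>\<bar>C\<bar> * \<delta> \<le> 1/2\<close>, so that a step halves the error; the
    \<open>+ 1\<close> covers \<open>C = 0\<close>.\<close>
  define \<delta> where "\<delta> = min \<delta>0 (min (r / 2) (1 / (2 * (\<bar>C\<bar> + 1))))"
  have \<delta>: "\<delta> > 0" "\<delta> \<le> \<delta>0" "\<delta> \<le> r / 2" and C\<delta>: "\<bar>C\<bar> * \<delta> \<le> 1/2"
  proof -
    show "\<delta> > 0" "\<delta> \<le> \<delta>0" "\<delta> \<le> r / 2" using \<open>\<delta>0 > 0\<close> \<open>r > 0\<close> by (auto simp: \<delta>_def)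
    have "\<bar>C\<bar> * \<delta> \<le> (\<bar>C\<bar> + 1) * (1 / (2 * (\<bar>C\<bar> + 1)))"
      using \<open>\<delta> > 0\<close> by (intro mult_mono) (auto simp: \<delta>_def)
    also have "\<dots> = 1/2" by (simp add: field_simps)
    finally show "\<bar>C\<bar> * \<delta> \<le> 1/2" .
  qed
  define U where "U = {p. dist p pbar < \<delta>}"
  \<comment> \<open>A product neighbourhood suffices: the step ignores the old \<open>\<mu>\<close>,
    and the new one returns to the \<open>\<epsilon>\<close>-ball, where all components are
    positive, whenever old and new pairs lie in \<open>U\<close>.\<close>
  define N where "N = {(x, y, \<mu>). (x, y) \<in> U \<and> dist \<mu> \<mu>bar < \<epsilon>}"

  have close: "linearized c x x' \<in> ball (c xbar) \<eta> \<and> dist (?mult x x' y') \<mu>bar < \<epsilon>"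
    if "(x, y) \<in> U" "(x', y') \<in> U" for x y x' y'
  proof (rule r)
    have "dist (x, x', y') (xbar, xbar, ybar) \<le> dist x xbar + dist (x', y') pbar"
      by (simp add: dist_norm norm_Pair_le pbar_def)
    moreover have "dist x xbar \<le> dist (x, y) pbar" using dist_fst_le[of "(x, y)" pbar] by (simp add: pbar_def)
    ultimately show "dist (x, x', y') (xbar, xbar, ybar) < r" using that \<delta>(3) by (auto simp: U_def)
  qed

  have "\<exists>x' y' l. ?eqs x y x' y' l \<and> norm ((x', y') - pbar) \<le> C * (norm ((x, y) - pbar))\<^sup>2 \<and>
      (\<forall>x'' y'' l''. ?eqs x y x'' y'' l'' \<longrightarrow> x'' = x' \<and> y'' = y')" if "(x, y) \<in> U" for x y
    using near[of x y] that \<delta>(2) by (auto simp: U_def)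
  then obtain X Y L where eqs: "\<And>x y. (x, y) \<in> U \<Longrightarrow> ?eqs x y (X x y) (Y x y) (L x y)"
    and quad: "\<And>x y. (x, y) \<in> U \<Longrightarrow> norm ((X x y, Y x y) - pbar) \<le> C * (norm ((x, y) - pbar))\<^sup>2"
    and eqs_unique: "\<And>x y x'' y'' l''. (x, y) \<in> U \<Longrightarrow> ?eqs x y x'' y'' l'' \<Longrightarrow> x'' = X x y \<and> y'' = Y x y"
    by metis
  have half: "norm ((X x y, Y x y) - pbar) \<le> 1/2 * norm ((x, y) - pbar)" if "(x, y) \<in> U" for x y
  proof -
    define s where "s = norm ((x, y) - pbar)"
    have s: "0 \<le> s" "s \<le> \<delta>" using that by (auto simp: s_def U_def dist_norm)
    have "C * s\<^sup>2 \<le> \<bar>C\<bar> * s * s" using s by (simp add: power2_eq_square mult.assoc mult_right_mono)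
    also have "\<dots> \<le> 1/2 * s"
      using s mult_left_mono[OF s(2), of "\<bar>C\<bar>"] C\<delta> by (intro mult_right_mono) linarith+
    finally show ?thesis using quad[OF that] by (simp add: s_def)
  qed
  have U_step: "(X x y, Y x y) \<in> U" if "(x, y) \<in> U" for x y
    using half[OF that] that norm_ge_zero[of "(x, y) - pbar"] unfolding U_def mem_Collect_eq dist_norm by linarith
  have mult_pos: "?mult x (X x y) (Y x y) $ i $ p > 0" if "(x, y) \<in> U" for x y i p
    using close[OF that U_step[OF that]] by (intro \<epsilon>) blast
  have opt: "linearized c x (X x y) \<in> manifold"
    "represents Q b \<kappa> A P (linearized c x (X x y)) (Y x y) (?mult x (X x y) (Y x y))"
    "newton_optimality h c Q b \<kappa> A P x y (X x y) (Y x y) (?mult x (X x y) (Y x y))" if "(x, y) \<in> U" for x y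
    using newton_equations_optimality[OF conjunct1[OF close[OF that U_step[OF that]]] mult_pos[OF that] eqs[OF that]]
    by simp_all

  have step_unique: "x' = X x y \<and> y' = Y x y \<and> \<mu>' = ?mult x (X x y) (Y x y)"
    if xy: "(x, y) \<in> U" and opt': "newton_optimality h c Q b \<kappa> A P x y x' y' \<mu>'"
      and alt: "(x', y', \<mu>') \<in> N \<or> linearized c x x' \<in> M" for x y x' y' \<mu>'
  proof -
    have rep: "represents Q b \<kappa> A P (linearized c x x') y' \<mu>'"
      and sub: "y' \<in> subdifferential h (linearized c x x')"
      using opt' by (auto simp: newton_optimality_def)
    \<comment> \<open>Flatness is all that is missing to reach the linear system: in
      \<open>N\<close> it comes from positivity of \<open>\<mu>'\<close>, on \<open>M\<close> from
      the description of \<open>M\<close> by the chart.\<close>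
    from alt have "transpose A *v linearized c x x' = transpose A *v c xbar"
    proof
      assume "(x', y', \<mu>') \<in> N"
      then have "(x', y') \<in> U" "\<And>i p. \<mu>' $ i $ p > 0" using \<epsilon> by (auto simp: N_def)
      then have "linearized c x x' \<in> manifold"
        using close[OF xy] by (intro positive_multiplier_manifold[OF _ sub rep]) auto
      then show ?thesis by (simp add: manifold_def)
    next
      assume "linearized c x x' \<in> M"
      then show ?thesis using M_flat cbar by simp
    qed
    from eqs_unique[OF xy newton_optimality_equations[OF opt' this]] represents_unique[OF rep]
    show ?thesis by simp
  qed

  show ?thesis
  proof (intro exI[of _ N] conjI allI impI)
    show "open N"
      unfolding N_def U_def mem_Collect_eq case_prod_beta prod.collapse
      by (intro open_Collect_conj open_Collect_less continuous_intros)
    show "(xbar, ybar, \<mu>bar) \<in> N" using \<delta>(1) \<open>\<epsilon> > 0\<close> by (simp add: N_def U_def pbar_def)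
  next
    fix x y \<mu> assume "(x, y, \<mu>) \<in> N"
    then have xy: "dist (x, y) pbar < \<delta>0" using \<delta>(2) by (simp add: N_def U_def)
    then show "Null (transpose (J x)) \<inter> Ran A = {0}" using near by blast
    show "\<forall>j\<in>active_pieces a \<alpha> \<omega> cbar. \<forall>d\<in>Null (transpose A ** J x) - {0}.
        d \<bullet> ((transpose (J x) ** Q j ** J x) *v d) + d \<bullet> (lagrangian_hessian c y x *v d) > 0"
    proof (intro ballI)
      fix j d assume "j \<in> active_pieces a \<alpha> \<omega> cbar" and d: "d \<in> Null (transpose A ** J x) - {0}"
      then obtain i where i: "j = \<kappa> i" using enum_pieces by (auto simp: bij_betw_def)
      have "\<gamma> * (norm d)\<^sup>2 \<le> d \<bullet> ((transpose (J x) ** Q (\<kappa> i) ** J x + lagrangian_hessian c y x) *v d)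
          + K * (norm ((transpose A ** J x) *v d))\<^sup>2"
        using near[OF xy] by blast
      moreover have "\<gamma> * (norm d)\<^sup>2 > 0" using d K(2) by simp
      \<comment> \<open>On the null space of \<open>transpose A ** J x\<close> the penalty
        vanishes.\<close>
      ultimately show "d \<bullet> ((transpose (J x) ** Q j ** J x) *v d) + d \<bullet> (lagrangian_hessian c y x *v d) > 0"
        using d by (simp add: i Null_def matrix_vector_mult_add_rdistrib inner_add_right)
    qed
  next
    fix x0 y0 \<mu>0 assume start: "(x0, y0, \<mu>0) \<in> N"
    define it where "it k = ((\<lambda>(x, y). (X x y, Y x y)) ^^ k) (x0, y0)" for k
    define xs ys where "xs k = fst (it k)" and "ys k = snd (it k)" for k
    \<comment> \<open>The initial multiplier is prescribed; each later one is determined by the step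
      that produced it and never feeds back into the iteration.\<close>
    define \<mu>s where "\<mu>s k = (case k of 0 \<Rightarrow> \<mu>0 | Suc j \<Rightarrow> ?mult (xs j) (xs (Suc j)) (ys (Suc j)))" for k
    have init: "xs 0 = x0" "ys 0 = y0" "\<mu>s 0 = \<mu>0" by (simp_all add: xs_def ys_def it_def \<mu>s_def)
    have it_Suc: "xs (Suc k) = X (xs k) (ys k)" "ys (Suc k) = Y (xs k) (ys k)"
      "\<mu>s (Suc k) = ?mult (xs k) (X (xs k) (ys k)) (Y (xs k) (ys k))" for k
      by (simp_all add: xs_def ys_def it_def \<mu>s_def case_prod_beta)
    have inU: "(xs k, ys k) \<in> U" for k
    proof (induction k)
      case 0
      then show ?case using start by (simp add: init N_def)
    next
      case (Suc k)
      then show ?case by (simp add: it_Suc U_step)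
    qed
    have inN: "(xs k, ys k, \<mu>s k) \<in> N" for k
    proof (cases k)
      case 0
      then show ?thesis using start by (simp add: init)
    next
      case [simp]: (Suc j)
      show ?thesis
        using inU[of k] close[OF inU U_step[OF inU[of j]], of j] by (simp add: N_def it_Suc)
    qed
    have seq: "newton_sequence h c Q b \<kappa> A P xs ys \<mu>s"
      unfolding newton_sequence_def it_Suc using opt(3) inU by blast
    have unique: "xs' = xs \<and> ys' = ys \<and> \<mu>s' = \<mu>s"
      if i: "xs' 0 = x0" "ys' 0 = y0" "\<mu>s' 0 = \<mu>0" and s: "newton_sequence h c Q b \<kappa> A P xs' ys' \<mu>s'"
        and alt: "(\<forall>k. (xs' k, ys' k, \<mu>s' k) \<in> N) \<or> (\<forall>k. linearized c (xs' k) (xs' (Suc k)) \<in> M)"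
      for xs' ys' \<mu>s'
    proof -
      have "xs' k = xs k \<and> ys' k = ys k \<and> \<mu>s' k = \<mu>s k" for k
      proof (induction k)
        case 0
        then show ?case by (simp add: i init)
      next
        case (Suc k)
        then have "newton_optimality h c Q b \<kappa> A P (xs k) (ys k) (xs' (Suc k)) (ys' (Suc k)) (\<mu>s' (Suc k))"
          using s unfolding newton_sequence_def by metis
        moreover have "(xs' (Suc k), ys' (Suc k), \<mu>s' (Suc k)) \<in> N \<or> linearized c (xs k) (xs' (Suc k)) \<in> M"
          using alt Suc by metis
        ultimately show ?case unfolding it_Suc by (rule step_unique[OF inU])
      qed
      then show ?thesis by auto
    qed
    have props: "linearized c (xs k) (xs (Suc k)) \<in> M \<and>
        (\<forall>i p. ?mult (xs k) (xs (Suc k)) (ys (Suc k)) $ i $ p > 0) \<and>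
        ys (Suc k) \<in> rel_interior (subdifferential h (linearized c (xs k) (xs (Suc k)))) \<and>
        lagrangian_hessian c (ys k) (xs k) *v (xs (Suc k) - xs k) + transpose (J (xs k)) *v ys (Suc k) = 0 \<and>
        strong_local_minimizer (newton_model h c (xs k) (ys k)) (xs (Suc k) - xs k)" for k
    proof (intro conjI allI)
      have z: "linearized c (xs k) (xs (Suc k)) \<in> manifold"
        and rep: "represents Q b \<kappa> A P (linearized c (xs k) (xs (Suc k))) (ys (Suc k))
          (?mult (xs k) (xs (Suc k)) (ys (Suc k)))"
        using opt(1,2)[OF inU] by (simp_all add: it_Suc)
      show "linearized c (xs k) (xs (Suc k)) \<in> M" using z flat_M by (auto simp: cbar)
      show pos: "?mult (xs k) (xs (Suc k)) (ys (Suc k)) $ i $ p > 0" for i p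
        unfolding it_Suc by (rule mult_pos[OF inU])
      show "ys (Suc k) \<in> rel_interior (subdifferential h (linearized c (xs k) (xs (Suc k))))"
        by (rule represents_rel_interior[OF z rep pos])
      show stat: "lagrangian_hessian c (ys k) (xs k) *v (xs (Suc k) - xs k) + transpose (J (xs k)) *v ys (Suc k) = 0"
        using seq by (simp add: newton_sequence_def newton_optimality_def)
      have "dist (xs k, ys k) pbar < \<delta>0" using inU[of k] \<delta>(2) by (simp add: U_def)
      from near[OF this]
      show "strong_local_minimizer (newton_model h c (xs k) (ys k)) (xs (Suc k) - xs k)"
        unfolding newton_model_def
        by (intro strong_local_minimizer_model[OF z[unfolded linearized_def] rep[unfolded linearized_def]
              pos[unfolded linearized_def] hessian_symmetric stat K(2,1)]) blast
    qed
    have conv: "converges_quadratically (\<lambda>k. (xs k, ys k)) (xbar, ybar)"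
      by (rule contraction_converges_quadratically) (use quad[OF inU] half[OF inU] in \<open>simp_all add: it_Suc pbar_def\<close>)
    show "\<exists>xs ys \<mu>s.
          xs 0 = x0 \<and> ys 0 = y0 \<and> \<mu>s 0 = \<mu>0 \<and>
          newton_sequence h c Q b \<kappa> A P xs ys \<mu>s \<and>
          (\<forall>k. (xs k, ys k, \<mu>s k) \<in> N) \<and>
          (\<forall>xs' ys' \<mu>s'.
             xs' 0 = x0 \<and> ys' 0 = y0 \<and> \<mu>s' 0 = \<mu>0 \<and>
             newton_sequence h c Q b \<kappa> A P xs' ys' \<mu>s' \<and>
             ((\<forall>k. (xs' k, ys' k, \<mu>s' k) \<in> N) \<or>
              (\<forall>k. linearized c (xs' k) (xs' (Suc k)) \<in> M)) \<longrightarrow>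
             xs' = xs \<and> ys' = ys \<and> \<mu>s' = \<mu>s) \<and>
          (\<forall>k. linearized c (xs k) (xs (Suc k)) \<in> M \<and>
               (\<forall>i p. ?mult (xs k) (xs (Suc k)) (ys (Suc k)) $ i $ p > 0) \<and>
               ys (Suc k) \<in> rel_interior (subdifferential h (linearized c (xs k) (xs (Suc k)))) \<and>
               lagrangian_hessian c (ys k) (xs k) *v (xs (Suc k) - xs k)
                 + transpose (J (xs k)) *v ys (Suc k) = 0 \<and>
               strong_local_minimizer (newton_model h c (xs k) (ys k)) (xs (Suc k) - xs k)) \<and>
          converges_quadratically (\<lambda>k. (xs k, ys k)) (xbar, ybar)"
      by (rule exI[of _ xs], rule exI[of _ ys], rule exI[of _ \<mu>s], intro conjI, (rule init seq)+,
          rule allI, rule inN, intro allI impI, elim conjE, rule unique, assumption+,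
          rule allI, rule props, rule conv)
  qed
qed

end
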